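(* Let $H$ be a Hilbert space with orthonormal basis $(e_i)_{i\in\mathbb N}$, $\mathbb N=\{1,2,\dots\}$. Let $T_0\in B(H)$ be the operator with $T_0e_i=e_{i+1}$ if $i$ is odd and $T_0e_i=0$ if $i$ is even. For each $n\in\mathbb N$ let $T_n\in B(H)$ be the rank one operator with $T_ne_{2n}=e_{2n+1}$ and $T_ne_i=0$ for $i\neq 2n$. Let $A$ be the norm-closed (non-unital) subalgebra of $B(H)$ generated by $\{T_n: n\ge 0\}$. Then $T_0\notin\operatorname{rad}A^{**}$, so $A\cap\operatorname{rad}A^{**}\subsetneq A=\operatorname{rad}A$.
   Context: $\operatorname{rad}$ denotes the Jacobson radical of a Banach algebra. $A^{**}$ is the bidual of $A$ with the Arens product; as $A$ is an operator algebra (a norm-closed subalgebra of some $B(H)$), it is Arens regular, so the two Arens products on $A^{**}$ coincide. $A$ is identified with its canonical image in $A^{**}$. *)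

theory Defs
  imports "HOL-Analysis.Analysis"
begin

section \<open>Complex Hilbert spaces\<close>

text \<open>The inner product is linear in the first argument. The norm laws are inherited from
  \<^class>\<open>banach\<close>; the last axiom ties that norm to the inner product.\<close>

class chilbert_space = banach +
  fixes cscale :: "complex \<Rightarrow> 'a \<Rightarrow> 'a" (infixr "*\<^sub>C" 75)
    and cinner :: "'a \<Rightarrow> 'a \<Rightarrow> complex"
  assumes cscale_add_right: "c *\<^sub>C (x + y) = c *\<^sub>C x + c *\<^sub>C y"
    and cscale_add_left: "(c + d) *\<^sub>C x = c *\<^sub>C x + d *\<^sub>C x"
    and cscale_cscale: "c *\<^sub>C d *\<^sub>C x = (c * d) *\<^sub>C x"
    and cscale_one: "1 *\<^sub>C x = x"
    and scaleR_cscale: "r *\<^sub>R x = complex_of_real r *\<^sub>C x"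
    and cinner_add_left: "cinner (x + y) z = cinner x z + cinner y z"
    and cinner_cscale_left: "cinner (c *\<^sub>C x) y = c * cinner x y"
    and cinner_commute: "cinner x y = cnj (cinner y x)"
    and norm_eq_sqrt_cinner: "norm x = sqrt (Re (cinner x x))"

global_interpretation complex_space:
  vector_space "cscale :: complex \<Rightarrow> 'a \<Rightarrow> 'a::chilbert_space"
  by unfold_locales
    (simp_all add: cscale_add_right cscale_add_left cscale_cscale cscale_one)

lemma norm_cscale: "norm (c *\<^sub>C x) = cmod c * norm (x::'a::chilbert_space)"
proof -
  have "cinner (c *\<^sub>C x) (c *\<^sub>C x) = c * cnj (c * cinner x x)"
    by (metis cinner_commute cinner_cscale_left)
  also have "\<dots> = complex_of_real ((cmod c)\<^sup>2) * cinner x x"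
    by (metis cinner_commute complex_cnj_mult complex_norm_square mult.assoc)
  finally have "Re (cinner (c *\<^sub>C x) (c *\<^sub>C x)) = (cmod c)\<^sup>2 * Re (cinner x x)"
    by simp
  then show ?thesis
    by (simp add: norm_eq_sqrt_cinner real_sqrt_mult)
qed

definition orthonormal_basis :: "('i \<Rightarrow> 'a::chilbert_space) \<Rightarrow> 'i set \<Rightarrow> bool" where
  "orthonormal_basis e I \<longleftrightarrow>
     (\<forall>i\<in>I. \<forall>j\<in>I. cinner (e i) (e j) = (if i = j then 1 else 0)) \<and>
     closure (complex_space.span (e ` I)) = UNIV"


section \<open>Bounded operators\<close>

text \<open>Elements of \<^typ>\<open>'a \<Rightarrow>\<^sub>L 'a\<close> are only real-linear, so $B(H)$ is the set of
  those that are complex-linear. Its norm is the operator norm of \<^typ>\<open>'a \<Rightarrow>\<^sub>L 'a\<close>.\<close>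

definition bounded_ops :: "('a::chilbert_space \<Rightarrow>\<^sub>L 'a) set" where
  "bounded_ops = {T. \<forall>c x. blinfun_apply T (c *\<^sub>C x) = c *\<^sub>C blinfun_apply T x}"

lift_definition op_scale ::
  "complex \<Rightarrow> ('a::chilbert_space \<Rightarrow>\<^sub>L 'a) \<Rightarrow> 'a \<Rightarrow>\<^sub>L 'a" is "\<lambda>c T x. c *\<^sub>C T x"
proof -
  fix c :: complex and T :: "'a \<Rightarrow> 'a"
  assume T: "bounded_linear T"
  have "bounded_linear (\<lambda>x::'a. c *\<^sub>C x)"
    by (rule bounded_linear_intro[where K = "cmod c"])
      (simp_all add: cscale_add_right scaleR_cscale cscale_cscale norm_cscale mult.commute)
  from bounded_linear_compose[OF this T] show "bounded_linear (\<lambda>x. c *\<^sub>C T x)" .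
qed

definition subalgebra :: "('a::chilbert_space \<Rightarrow>\<^sub>L 'a) set \<Rightarrow> bool" where
  "subalgebra B \<longleftrightarrow> B \<subseteq> bounded_ops \<and> 0 \<in> B \<and>
     (\<forall>S\<in>B. \<forall>T\<in>B. S + T \<in> B) \<and> (\<forall>c. \<forall>T\<in>B. op_scale c T \<in> B) \<and>
     (\<forall>S\<in>B. \<forall>T\<in>B. S o\<^sub>L T \<in> B)"

definition closed_subalgebra_generated ::
  "('a::chilbert_space \<Rightarrow>\<^sub>L 'a) set \<Rightarrow> ('a \<Rightarrow>\<^sub>L 'a) set" where
  "closed_subalgebra_generated S = \<Inter>{B. subalgebra B \<and> closed B \<and> S \<subseteq> B}"


section \<open>Normed spaces and algebras with explicit carriers\<close>

text \<open>All scalars are complex. The records only collect the operations; no unit is assumed.\<close>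

record 'a normed_space =
  carrier :: "'a set"
  add :: "'a \<Rightarrow> 'a \<Rightarrow> 'a"
  zero :: 'a
  scale :: "complex \<Rightarrow> 'a \<Rightarrow> 'a"
  nrm :: "'a \<Rightarrow> real"

record 'a normed_algebra = "'a normed_space" +
  mult :: "'a \<Rightarrow> 'a \<Rightarrow> 'a"

definition operator_algebra ::
  "('a::chilbert_space \<Rightarrow>\<^sub>L 'a) set \<Rightarrow> ('a \<Rightarrow>\<^sub>L 'a) normed_algebra" where
  "operator_algebra B =
     \<lparr>carrier = B, add = (+), zero = 0, scale = op_scale, nrm = norm, mult = (o\<^sub>L)\<rparr>"


section \<open>Jacobson radical\<close>

definition left_ideal :: "('a, 'm) normed_algebra_scheme \<Rightarrow> 'a set \<Rightarrow> bool" where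
  "left_ideal M J \<longleftrightarrow> J \<subseteq> carrier M \<and> zero M \<in> J \<and>
     (\<forall>x\<in>J. \<forall>y\<in>J. add M x y \<in> J) \<and> (\<forall>c. \<forall>x\<in>J. scale M c x \<in> J) \<and>
     (\<forall>a\<in>carrier M. \<forall>x\<in>J. mult M a x \<in> J)"

text \<open>Modularity: $a - au \in J$ for all $a$, for some right unit $u$ modulo $J$.\<close>

definition modular_left_ideal :: "('a, 'm) normed_algebra_scheme \<Rightarrow> 'a set \<Rightarrow> bool" where
  "modular_left_ideal M J \<longleftrightarrow> left_ideal M J \<and>
     (\<exists>u\<in>carrier M. \<forall>a\<in>carrier M. add M a (scale M (-1) (mult M a u)) \<in> J)"

definition maximal_modular_left_ideal ::
  "('a, 'm) normed_algebra_scheme \<Rightarrow> 'a set \<Rightarrow> bool" where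
  "maximal_modular_left_ideal M J \<longleftrightarrow> modular_left_ideal M J \<and> J \<noteq> carrier M \<and>
     (\<forall>J'. left_ideal M J' \<and> J \<subseteq> J' \<longrightarrow> J' = J \<or> J' = carrier M)"

text \<open>Ideals need not be closed. If there is no maximal modular left ideal, the radical is
  the whole algebra.\<close>

definition jacobson_radical :: "('a, 'm) normed_algebra_scheme \<Rightarrow> 'a set" where
  "jacobson_radical M =
     {a \<in> carrier M. \<forall>J. maximal_modular_left_ideal M J \<longrightarrow> a \<in> J}"


section \<open>Duals and the Arens product\<close>

text \<open>Functionals are extensional functions on the carrier, so that equality of functionals
  is equality of functions.\<close>

definition dual :: "('a, 'm) normed_space_scheme \<Rightarrow> ('a \<Rightarrow> complex) normed_space" where
  "dual M =
     \<lparr>carrier = {f \<in> extensional (carrier M).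
        (\<forall>x\<in>carrier M. \<forall>y\<in>carrier M. f (add M x y) = f x + f y) \<and>
        (\<forall>c. \<forall>x\<in>carrier M. f (scale M c x) = c * f x) \<and>
        (\<exists>K. \<forall>x\<in>carrier M. cmod (f x) \<le> K * nrm M x)},
      add = (\<lambda>f g. \<lambda>x\<in>carrier M. f x + g x),
      zero = (\<lambda>x\<in>carrier M. 0),
      scale = (\<lambda>c f. \<lambda>x\<in>carrier M. c * f x),
      nrm = (\<lambda>f. SUP x\<in>{x \<in> carrier M. nrm M x \<le> 1}. cmod (f x))\<rparr>"

definition canonical :: "('a, 'm) normed_space_scheme \<Rightarrow> 'a \<Rightarrow> ('a \<Rightarrow> complex) \<Rightarrow> complex" where
  "canonical M a = (\<lambda>f\<in>carrier (dual M). f a)"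

text \<open>The first Arens product $(F \mathbin{\Box} G)(f) = F(G \cdot f)$, where
  $(G \cdot f)(a) = G(f \cdot a)$ and $(f \cdot a)(b) = f(ab)$.\<close>

definition arens_product ::
  "('a, 'm) normed_algebra_scheme \<Rightarrow> (('a \<Rightarrow> complex) \<Rightarrow> complex) \<Rightarrow>
     (('a \<Rightarrow> complex) \<Rightarrow> complex) \<Rightarrow> ('a \<Rightarrow> complex) \<Rightarrow> complex" where
  "arens_product M F G =
     (\<lambda>f\<in>carrier (dual M). F (\<lambda>a\<in>carrier M. G (\<lambda>b\<in>carrier M. f (mult M a b))))"

definition bidual ::
  "('a, 'm) normed_algebra_scheme \<Rightarrow> (('a \<Rightarrow> complex) \<Rightarrow> complex) normed_algebra" where
  "bidual M =
     \<lparr>carrier = carrier (dual (dual M)), add = add (dual (dual M)),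
      zero = zero (dual (dual M)), scale = scale (dual (dual M)),
      nrm = nrm (dual (dual M)), mult = arens_product M\<rparr>"

end

theory Submission imports Defs begin

text \<open>Why \<open>A\<close> is radical. Every element of \<open>A\<close> maps the vectors orthogonal to
  \<open>e\<^sub>1, \<dots>, e\<^sub>i\<close> to vectors orthogonal to \<open>e\<^sub>1, \<dots>, e\<^sub>i\<^sub>+\<^sub>1\<close>
  (\<open>C_tail\<close>). Since \<open>T\<^sub>n\<close> for \<open>n \<ge> 1\<close> sends \<open>e\<^sub>2\<^sub>n\<close> further down the basis and
  kills the other basis vectors, it follows that \<open>T\<^sub>n a T\<^sub>n = 0\<close> for all \<open>a \<in> A\<close>. So
  \<open>T\<^sub>n\<close> and all \<open>T\<^sub>n a\<close> generate left ideals of square zero, and these lie in every maximal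
  modular left ideal \<open>J\<close>. As \<open>J\<close> is closed, the largest two-sided ideal \<open>R\<close> inside \<open>J\<close> is
  closed, and \<open>A\<close> is spanned by \<open>T\<^sub>0\<close> modulo \<open>R\<close>. Now \<open>T\<^sub>0\<^sup>2 = 0\<close> forces the
  modular unit of \<open>J\<close> into \<open>J\<close>, a contradiction: there is no such \<open>J\<close> at all.

  Why \<open>T\<^sub>0\<close> leaves the radical in the bidual. The operators \<open>T\<^sub>1 + \<dots> + T\<^sub>N\<close> do
  not converge in norm, but they do converge weak-* in \<open>A\<^sup>*\<^sup>*\<close>: the closed span of the
  \<open>T\<^sub>n\<close> with \<open>n \<ge> 1\<close> is a copy of \<open>c\<^sub>0\<close>, so \<open>\<Sum> f(T\<^sub>n)\<close> converges
  absolutely for every functional \<open>f\<close>. Let \<open>W\<close> be the product of the limit with \<open>T\<^sub>0\<close>. On the coefficient functionals \<open>a \<mapsto> \<langle>a x, y\<rangle>\<close> it acts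
  like the isometric shift \<open>e\<^sub>1 \<mapsto> e\<^sub>3 \<mapsto> e\<^sub>5 \<mapsto> \<dots>\<close>, which has the approximate eigenvalue 1.
  If \<open>T\<^sub>0\<close> were in the radical, then \<open>W\<close> would have a left quasi-inverse, and \<open>1 - W\<close> a left
  inverse. But for \<open>x = e\<^sub>1 + e\<^sub>3 + \<dots>\<close> with \<open>m\<close> terms the sum \<open>x - Wx\<close> telescopes to a
  difference of two basis vectors; pairing with \<open>y = Wx\<close>, of norm \<open>\<surd>m\<close>, gives
  \<open>m \<le> 2 K \<surd>m\<close> for a constant \<open>K\<close> and all \<open>m\<close> (\<open>W_not_quasi_regular\<close>).\<close>

section \<open>Complex inner products\<close>

lemma cinner_zero_left [simp]: "cinner 0 (y::'a::chilbert_space) = 0"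
  using cinner_add_left[of 0 0 y] by simp

lemma cinner_zero_right [simp]: "cinner (x::'a::chilbert_space) 0 = 0"
  using cinner_commute[of x 0] by simp

lemma cinner_add_right:
  "cinner (x::'a::chilbert_space) (y + z) = cinner x y + cinner x z"
  by (metis cinner_add_left cinner_commute complex_cnj_add)

lemma cinner_cscale_right:
  "cinner (x::'a::chilbert_space) (c *\<^sub>C y) = cnj c * cinner x y"
  by (metis cinner_cscale_left cinner_commute complex_cnj_mult)

lemma cinner_sum_left: "cinner (sum f S) (y::'a::chilbert_space) = (\<Sum>i\<in>S. cinner (f i) y)"
  by (induction S rule: infinite_finite_induct) (simp_all add: cinner_add_left)

lemma cinner_sum_right: "cinner (x::'a::chilbert_space) (sum f S) = (\<Sum>i\<in>S. cinner x (f i))"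
  by (induction S rule: infinite_finite_induct) (simp_all add: cinner_add_right)

lemma cinner_self: "cinner x x = complex_of_real ((norm (x::'a::chilbert_space))\<^sup>2)"
proof -
  have "Re (cinner x x) \<ge> 0"
    using norm_ge_zero[of x] norm_eq_sqrt_cinner[of x] by (metis real_sqrt_ge_0_iff)
  then have "Re (cinner x x) = (norm x)\<^sup>2"
    using norm_eq_sqrt_cinner[of x] by simp
  moreover have "Im (cinner x x) = 0"
    using cinner_commute[of x x] by (metis complex_cnj complex.sel(2) cnj.simps(2) neg_equal_zero)
  ultimately show ?thesis by (simp add: complex_eq_iff)
qed

text \<open>The triangle inequality is already part of the class, so squaring it bounds the real part
  of the inner product; a unimodular factor turns the real part into the modulus.\<close>

lemma Cauchy_Schwarz: "cmod (cinner x y) \<le> norm x * norm (y::'a::chilbert_space)"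
proof -
  have re: "Re (cinner x y) \<le> norm x * norm y" for x y :: 'a
  proof -
    have "cinner (x + y) (x + y) = cinner x x + cinner y y + (cinner x y + cnj (cinner x y))"
      by (simp add: cinner_add_left cinner_add_right flip: cinner_commute)
    then have "(norm (x + y))\<^sup>2 = (norm x)\<^sup>2 + (norm y)\<^sup>2 + 2 * Re (cinner x y)"
      by (simp add: cinner_self complex_eq_iff)
    moreover have "(norm (x + y))\<^sup>2 \<le> (norm x + norm y)\<^sup>2"
      by (simp add: norm_triangle_ineq power_mono)
    ultimately show ?thesis by (simp add: power2_sum)
  qed
  define c where "c = cnj (sgn (cinner x y))"
  have "c * cinner x y = complex_of_real (cmod (cinner x y))"
    using complex_norm_square[of "cinner x y"]
    by (cases "cinner x y = 0")
       (auto simp: c_def sgn_div_norm scaleR_conv_of_real field_simps power2_eq_square)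
  then have "cmod (cinner x y) = Re (cinner (c *\<^sub>C x) y)"
    by (simp add: cinner_cscale_left)
  also have "\<dots> \<le> norm (c *\<^sub>C x) * norm y" by (rule re)
  also have "\<dots> \<le> norm x * norm y"
    by (intro mult_right_mono) (auto simp: norm_cscale c_def norm_sgn)
  finally show ?thesis .
qed

lemma bounded_linear_cinner_left: "bounded_linear (\<lambda>x::'a::chilbert_space. cinner x y)"
  by (rule bounded_linear_intro[where K = "norm y"])
     (auto simp: cinner_add_left cinner_cscale_left scaleR_cscale scaleR_conv_of_real Cauchy_Schwarz)

lemmas continuous_on_cinner_left [continuous_intros] =
  bounded_linear.continuous_on[OF bounded_linear_cinner_left]

lemma bounded_linear_cscale_right: "bounded_linear (\<lambda>x::'a::chilbert_space. c *\<^sub>C x)"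
  by (rule bounded_linear_intro[where K = "cmod c"])
     (simp_all add: cscale_add_right scaleR_cscale cscale_cscale norm_cscale mult.commute)

lemma bounded_linear_cscale_left: "bounded_linear (\<lambda>c. c *\<^sub>C (x::'a::chilbert_space))"
  by (rule bounded_linear_intro[where K = "norm x"])
     (simp_all add: cscale_add_left scaleR_cscale cscale_cscale norm_cscale scaleR_conv_of_real)

lemma norm_orthonormal_sum:
  fixes e :: "'i \<Rightarrow> 'a::chilbert_space"
  assumes "finite S" and "\<And>i j. i \<in> S \<Longrightarrow> j \<in> S \<Longrightarrow> cinner (e i) (e j) = (if i = j then 1 else 0)"
  shows "(norm (\<Sum>i\<in>S. d i *\<^sub>C e i))\<^sup>2 = (\<Sum>i\<in>S. (cmod (d i))\<^sup>2)"
proof -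
  let ?s = "\<Sum>i\<in>S. d i *\<^sub>C e i"
  have "cinner ?s ?s = (\<Sum>i\<in>S. \<Sum>j\<in>S. d i * (cnj (d j) * cinner (e i) (e j)))"
    by (simp only: cinner_sum_left)
       (simp add: cinner_sum_right cinner_cscale_left cinner_cscale_right sum_distrib_left mult.left_commute)
  also have "\<dots> = (\<Sum>i\<in>S. \<Sum>j\<in>S. if i = j then complex_of_real ((cmod (d i))\<^sup>2) else 0)"
    by (intro sum.cong refl) (simp add: assms(2) complex_norm_square del: of_real_power)
  also have "\<dots> = complex_of_real (\<Sum>i\<in>S. (cmod (d i))\<^sup>2)"
    using assms(1) by simp
  finally show ?thesis by (simp only: cinner_self of_real_eq_iff)
qed

lemma Bessel:
  fixes e :: "'i \<Rightarrow> 'a::chilbert_space"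
  assumes "finite S" and "\<And>i j. i \<in> S \<Longrightarrow> j \<in> S \<Longrightarrow> cinner (e i) (e j) = (if i = j then 1 else 0)"
  shows "(\<Sum>i\<in>S. (cmod (cinner x (e i)))\<^sup>2) \<le> (norm x)\<^sup>2"
proof -
  let ?p = "\<Sum>i\<in>S. cinner x (e i) *\<^sub>C e i"
  have p: "(norm ?p)\<^sup>2 = (\<Sum>i\<in>S. (cmod (cinner x (e i)))\<^sup>2)"
    by (rule norm_orthonormal_sum[OF assms])
  have "cinner x ?p = complex_of_real ((norm ?p)\<^sup>2)"
    by (simp add: p cinner_sum_right cinner_cscale_right complex_norm_square mult.commute
        del: of_real_power)
  then have "(norm ?p)\<^sup>2 \<le> norm x * norm ?p"
    using Cauchy_Schwarz[of x ?p] by (simp add: norm_power)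
  then have "norm ?p \<le> norm x"
    by (cases "norm ?p = 0") (simp_all add: power2_eq_square)
  then show ?thesis unfolding p[symmetric] by (intro power_mono) auto
qed

text \<open>The tool for extending identities between operators from the basis to the whole space.\<close>

lemma closed_subspace_eq_UNIV:
  assumes "orthonormal_basis e I" and "complex_space.subspace V" and "closed V"
    and "\<And>i. i \<in> I \<Longrightarrow> e i \<in> V"
  shows "V = UNIV"
proof -
  have "complex_space.span (e ` I) \<subseteq> V"
    using assms(2,4) by (intro complex_space.span_minimal) auto
  then have "closure (complex_space.span (e ` I)) \<subseteq> V"
    using assms(3) by (rule closure_minimal)
  then show ?thesis using assms(1) by (auto simp: orthonormal_basis_def)
qed

section \<open>Algebras of bounded operators\<close>

lemma bounded_opsD: "S \<in> bounded_ops \<Longrightarrow> blinfun_apply S (c *\<^sub>C x) = c *\<^sub>C blinfun_apply S x"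
  by (simp add: bounded_ops_def)

lemma op_scale_apply [simp]: "blinfun_apply (op_scale c S) x = c *\<^sub>C blinfun_apply S x"
  by transfer simp

lemma norm_op_scale: "norm (op_scale c S) = cmod c * norm S"
proof -
  have le: "norm (op_scale c S) \<le> cmod c * norm S" for c and S :: "'a \<Rightarrow>\<^sub>L 'a"
  proof (rule norm_blinfun_bound)
    show "norm (blinfun_apply (op_scale c S) x) \<le> cmod c * norm S * norm x" for x
      using mult_left_mono[OF norm_blinfun[of S x], of "cmod c"] by (simp add: norm_cscale mult.assoc)
  qed simp
  show ?thesis
  proof (cases "c = 0")
    case True
    then show ?thesis using le[of c S] by simp
  next
    case False
    have "S = op_scale (inverse c) (op_scale c S)"
      using False by (intro blinfun_eqI) (simp add: cscale_cscale cscale_one)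
    then have "norm S \<le> cmod (inverse c) * norm (op_scale c S)"
      using le by metis
    then show ?thesis using False le[of c S]
      by (simp add: norm_inverse norm_divide field_simps)
  qed
qed

lemma op_scale_simps:
  "op_scale c (S + S') = op_scale c S + op_scale c S'"
  "op_scale (c + d) S = op_scale c S + op_scale d S"
  "op_scale c (op_scale d S) = op_scale (c * d) S"
  "op_scale 1 S = S" "op_scale (- 1) S = - S" "op_scale 0 S = 0"
  by (rule blinfun_eqI; simp add: blinfun.add_left blinfun.minus_left cscale_add_right
      cscale_add_left cscale_cscale cscale_one)+

lemma compose_simps:
  "(S + S') o\<^sub>L R = (S o\<^sub>L R) + (S' o\<^sub>L R)"
  "R o\<^sub>L (S + S') = (R o\<^sub>L S) + (R o\<^sub>L S')"
  "(S - S') o\<^sub>L R = (S o\<^sub>L R) - (S' o\<^sub>L R)"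
  "R o\<^sub>L (S - S') = (R o\<^sub>L S) - (R o\<^sub>L S')"
  "(op_scale c P) o\<^sub>L Q = op_scale c (P o\<^sub>L Q)"
  "P \<in> bounded_ops \<Longrightarrow> P o\<^sub>L (op_scale c Q) = op_scale c (P o\<^sub>L Q)"
  "(R o\<^sub>L S) o\<^sub>L S'' = R o\<^sub>L (S o\<^sub>L S'')"
  "0 o\<^sub>L S = 0" "S o\<^sub>L 0 = 0"
  by (rule blinfun_eqI; simp add: blinfun.add_left blinfun.add_right blinfun.diff_left
      blinfun.diff_right bounded_opsD)+

lemma bounded_linear_op_scale: "bounded_linear (\<lambda>S. op_scale c S)"
  by (rule bounded_linear_intro[where K = "cmod c"])
     (auto intro!: blinfun_eqI simp: op_scale_simps norm_op_scale scaleR_cscale cscale_cscale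
        blinfun.scaleR_left mult.commute)

lemma bounded_linear_op_scale_left: "bounded_linear (\<lambda>c. op_scale c S)"
  by (rule bounded_linear_intro[where K = "norm S"])
     (auto intro!: blinfun_eqI simp: op_scale_simps norm_op_scale scaleR_cscale cscale_cscale
        blinfun.scaleR_left scaleR_conv_of_real)

lemma subalgebra_bounded_ops: "subalgebra bounded_ops"
  by (auto simp: subalgebra_def bounded_ops_def blinfun.add_left cscale_add_right cscale_cscale mult.commute)

lemma closed_bounded_ops: "closed (bounded_ops :: ('a::chilbert_space \<Rightarrow>\<^sub>L 'a) set)"
proof -
  have eq: "bounded_ops = (\<Inter>c. \<Inter>x. {S::'a \<Rightarrow>\<^sub>L 'a. blinfun_apply S (c *\<^sub>C x) = c *\<^sub>C blinfun_apply S x})"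
    by (auto simp: bounded_ops_def)
  have "closed {S::'a \<Rightarrow>\<^sub>L 'a. blinfun_apply S (c *\<^sub>C x) = c *\<^sub>C blinfun_apply S x}" for c x
    by (intro closed_Collect_eq continuous_intros
        bounded_linear.continuous_on[OF bounded_linear_cscale_right])
  then show ?thesis unfolding eq by (intro closed_INT ballI)
qed

lemma closed_subalgebra_generated:
  assumes "S \<subseteq> bounded_ops"
  shows "subalgebra (closed_subalgebra_generated S)" "closed (closed_subalgebra_generated S)"
    "S \<subseteq> closed_subalgebra_generated S"
    "\<And>B. subalgebra B \<Longrightarrow> closed B \<Longrightarrow> S \<subseteq> B \<Longrightarrow> closed_subalgebra_generated S \<subseteq> B"
proof -
  have "closed_subalgebra_generated S \<subseteq> bounded_ops"
    using assms subalgebra_bounded_ops closed_bounded_ops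
    by (auto simp: closed_subalgebra_generated_def)
  then show "subalgebra (closed_subalgebra_generated S)"
    by (auto simp: subalgebra_def closed_subalgebra_generated_def)
qed (auto simp: closed_subalgebra_generated_def)

lemma subalgebra_closed_ops:
  assumes "subalgebra B"
  shows "B \<subseteq> bounded_ops" "0 \<in> B" "S \<in> B \<Longrightarrow> S' \<in> B \<Longrightarrow> S + S' \<in> B"
    "S \<in> B \<Longrightarrow> op_scale c S \<in> B" "S \<in> B \<Longrightarrow> S' \<in> B \<Longrightarrow> S o\<^sub>L S' \<in> B"
    "S \<in> B \<Longrightarrow> S' \<in> B \<Longrightarrow> S - S' \<in> B"
    "S \<in> B \<Longrightarrow> S \<in> bounded_ops"
proof -
  show "S - S' \<in> B" if "S \<in> B" "S' \<in> B"
    using assms that op_scale_simps(5)[of S'] unfolding subalgebra_def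
    by (metis add_uminus_conv_diff)
qed (use assms in \<open>auto simp: subalgebra_def\<close>)

lemma operator_algebra_simps [simp]:
  "carrier (operator_algebra B) = B" "add (operator_algebra B) = (+)" "zero (operator_algebra B) = 0"
  "scale (operator_algebra B) = op_scale" "nrm (operator_algebra B) = norm"
  "mult (operator_algebra B) = (o\<^sub>L)"
  by (simp_all add: operator_algebra_def)


section \<open>Quasi-regularity and the Jacobson radical\<close>

locale complex_algebra =
  fixes M :: "('a, 'm) normed_algebra_scheme"
  assumes add_closed: "x \<in> carrier M \<Longrightarrow> y \<in> carrier M \<Longrightarrow> add M x y \<in> carrier M"
    and zero_closed: "zero M \<in> carrier M"
    and scale_closed: "x \<in> carrier M \<Longrightarrow> scale M c x \<in> carrier M"
    and mult_closed: "x \<in> carrier M \<Longrightarrow> y \<in> carrier M \<Longrightarrow> mult M x y \<in> carrier M"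
    and add_assoc: "x \<in> carrier M \<Longrightarrow> y \<in> carrier M \<Longrightarrow> z \<in> carrier M \<Longrightarrow>
      add M (add M x y) z = add M x (add M y z)"
    and add_commute: "x \<in> carrier M \<Longrightarrow> y \<in> carrier M \<Longrightarrow> add M x y = add M y x"
    and add_zero: "x \<in> carrier M \<Longrightarrow> add M x (zero M) = x"
    and add_inverse: "x \<in> carrier M \<Longrightarrow> add M x (scale M (- 1) x) = zero M"
    and scale_add_right: "x \<in> carrier M \<Longrightarrow> y \<in> carrier M \<Longrightarrow>
      scale M c (add M x y) = add M (scale M c x) (scale M c y)"
    and scale_add_left: "x \<in> carrier M \<Longrightarrow> scale M (c + d) x = add M (scale M c x) (scale M d x)"
    and scale_scale: "x \<in> carrier M \<Longrightarrow> scale M c (scale M d x) = scale M (c * d) x"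
    and scale_one: "x \<in> carrier M \<Longrightarrow> scale M 1 x = x"
    and mult_assoc: "x \<in> carrier M \<Longrightarrow> y \<in> carrier M \<Longrightarrow> z \<in> carrier M \<Longrightarrow>
      mult M (mult M x y) z = mult M x (mult M y z)"
    and mult_add_left: "x \<in> carrier M \<Longrightarrow> y \<in> carrier M \<Longrightarrow> z \<in> carrier M \<Longrightarrow>
      mult M (add M x y) z = add M (mult M x z) (mult M y z)"
    and mult_add_right: "x \<in> carrier M \<Longrightarrow> y \<in> carrier M \<Longrightarrow> z \<in> carrier M \<Longrightarrow>
      mult M z (add M x y) = add M (mult M z x) (mult M z y)"
    and mult_scale_left: "x \<in> carrier M \<Longrightarrow> y \<in> carrier M \<Longrightarrow>
      mult M (scale M c x) y = scale M c (mult M x y)"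
    and mult_scale_right: "x \<in> carrier M \<Longrightarrow> y \<in> carrier M \<Longrightarrow>
      mult M x (scale M c y) = scale M c (mult M x y)"
begin

lemmas closed = add_closed zero_closed scale_closed mult_closed

lemma add_left_commute:
  "x \<in> carrier M \<Longrightarrow> y \<in> carrier M \<Longrightarrow> z \<in> carrier M \<Longrightarrow>
    add M x (add M y z) = add M y (add M x z)"
  by (metis add_assoc add_commute)

lemma scale_zero: "x \<in> carrier M \<Longrightarrow> scale M 0 x = zero M"
  using scale_add_left[of x 1 "- 1"] by (simp add: scale_one add_inverse)

text \<open>Formally \<open>(1 + b)(1 - u) = 1 - u + (b - bu)\<close>, so solutions \<open>b\<close> of
  \<open>sub_mult u b = u\<close> are the left quasi-inverses of \<open>u\<close>.\<close>

definition sub_mult :: "'a \<Rightarrow> 'a \<Rightarrow> 'a" where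
  "sub_mult u b = add M b (scale M (- 1) (mult M b u))"

lemma left_ideal_range_sub_mult:
  assumes u: "u \<in> carrier M"
  shows "left_ideal M (sub_mult u ` carrier M)"
  unfolding left_ideal_def
proof (intro conjI ballI allI)
  show "sub_mult u ` carrier M \<subseteq> carrier M"
    using u by (auto simp: sub_mult_def closed)
  have "sub_mult u (scale M 0 u) = scale M 0 (sub_mult u u)"
    using u by (simp add: sub_mult_def scale_add_right mult_scale_left scale_scale closed)
  then have "sub_mult u (zero M) = zero M"
    using u by (simp add: scale_zero closed sub_mult_def)
  then show "zero M \<in> sub_mult u ` carrier M"
    using zero_closed by (metis imageI)
next
  fix x y assume "x \<in> sub_mult u ` carrier M" "y \<in> sub_mult u ` carrier M"
  then obtain b c where bc: "b \<in> carrier M" "c \<in> carrier M" "x = sub_mult u b" "y = sub_mult u c"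
    by auto
  have "add M x y = sub_mult u (add M b c)"
    using u bc
    by (simp add: sub_mult_def scale_add_right mult_add_left closed add_assoc add_left_commute)
  then show "add M x y \<in> sub_mult u ` carrier M" using bc by (auto simp: closed)
next
  fix c x assume "x \<in> sub_mult u ` carrier M"
  then obtain b where b: "b \<in> carrier M" "x = sub_mult u b" by auto
  have "scale M c x = sub_mult u (scale M c b)"
    using u b
    by (simp add: sub_mult_def scale_add_right mult_scale_left scale_scale closed mult.commute)
  then show "scale M c x \<in> sub_mult u ` carrier M" using b by (auto simp: closed)
next
  fix a x assume a: "a \<in> carrier M" and "x \<in> sub_mult u ` carrier M"
  then obtain b where b: "b \<in> carrier M" "x = sub_mult u b" by auto
  have "mult M a x = sub_mult u (mult M a b)"
    using u a b by (simp add: sub_mult_def mult_add_right mult_scale_right mult_assoc closed)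
  then show "mult M a x \<in> sub_mult u ` carrier M" using a b by (auto simp: closed)
qed

text \<open>A left ideal that contains \<open>u\<close> and every \<open>a - au\<close> is everything, so among
  the left ideals above the range of \<open>b \<mapsto> b - bu\<close>, being proper means avoiding the single
  element \<open>u\<close>. This property survives unions of chains, and Zorn's lemma applies.\<close>

lemma ex_maximal_modular_left_ideal:
  assumes u: "u \<in> carrier M" and irregular: "u \<notin> sub_mult u ` carrier M"
  shows "\<exists>J. maximal_modular_left_ideal M J \<and> u \<notin> J"
proof -
  let ?J0 = "sub_mult u ` carrier M"
  define P where "P = {J. left_ideal M J \<and> ?J0 \<subseteq> J \<and> u \<notin> J}"
  have "?J0 \<in> P"
    using left_ideal_range_sub_mult[OF u] irregular by (simp add: P_def)
  moreover have "\<Union>C \<in> P" if C: "C \<noteq> {}" "subset.chain P C" for C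
  proof -
    have CP: "\<And>J. J \<in> C \<Longrightarrow> left_ideal M J \<and> ?J0 \<subseteq> J \<and> u \<notin> J"
      using C by (auto simp: P_def subset.chain_def)
    have "\<exists>J\<in>C. x \<in> J \<and> y \<in> J" if "x \<in> \<Union>C" "y \<in> \<Union>C" for x y
      using that C unfolding subset.chain_def by blast
    then have "\<forall>x\<in>\<Union>C. \<forall>y\<in>\<Union>C. add M x y \<in> \<Union>C"
      using CP unfolding left_ideal_def by (metis UnionI)
    moreover have "\<forall>c. \<forall>x\<in>\<Union>C. scale M c x \<in> \<Union>C" "\<forall>a\<in>carrier M. \<forall>x\<in>\<Union>C. mult M a x \<in> \<Union>C"
      using CP unfolding left_ideal_def by (metis UnionE UnionI)+
    moreover have "\<Union>C \<subseteq> carrier M" "u \<notin> \<Union>C"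
      using CP unfolding left_ideal_def by (meson Union_least, meson UnionE)
    moreover have "zero M \<in> \<Union>C" "?J0 \<subseteq> \<Union>C"
      using C(1) CP unfolding left_ideal_def
      by (meson Union_iff ex_in_conv, meson Union_upper ex_in_conv subset_trans)
    ultimately show ?thesis
      unfolding P_def left_ideal_def by blast
  qed
  ultimately obtain J where J: "J \<in> P" and max: "\<And>J'. J' \<in> P \<Longrightarrow> J \<subseteq> J' \<Longrightarrow> J' = J"
    using subset_Zorn_nonempty[of P] by blast
  have "J' = carrier M" if J': "left_ideal M J'" "J \<subseteq> J'" "u \<in> J'" for J'
  proof -
    have "a \<in> J'" if a: "a \<in> carrier M" for a
    proof -
      have "sub_mult u a \<in> J'" "mult M a u \<in> J'"
        using J J' a by (auto simp: P_def left_ideal_def)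
      moreover have "add M (sub_mult u a) (mult M a u) = a"
        using u a
        by (simp add: sub_mult_def add_assoc closed add_commute[of "scale M (- 1) (mult M a u)"]
            add_inverse add_zero)
      ultimately show ?thesis using J'(1) unfolding left_ideal_def by metis
    qed
    then show ?thesis using J'(1) by (auto simp: left_ideal_def)
  qed
  moreover have "modular_left_ideal M J"
    using J u by (auto simp: P_def modular_left_ideal_def sub_mult_def)
  moreover have "u \<notin> J" "?J0 \<subseteq> J" using J by (auto simp: P_def)
  ultimately have "maximal_modular_left_ideal M J"
    using max u unfolding maximal_modular_left_ideal_def P_def by blast
  with \<open>u \<notin> J\<close> show ?thesis by blast
qed

text \<open>The radical element \<open>a\<close> lies in every maximal modular left ideal, hence so does \<open>ca\<close>, and
  the previous lemma leaves no room for \<open>ca\<close> to lack a left quasi-inverse.\<close>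

lemma jacobson_radical_left_quasi_regular:
  assumes "a \<in> jacobson_radical M" "c \<in> carrier M"
  shows "\<exists>b\<in>carrier M. sub_mult (mult M c a) b = mult M c a"
proof (rule ccontr)
  assume "\<not> ?thesis"
  moreover have ca: "mult M c a \<in> carrier M"
    using assms by (auto simp: jacobson_radical_def closed)
  ultimately obtain J where J: "maximal_modular_left_ideal M J" "mult M c a \<notin> J"
    using ex_maximal_modular_left_ideal[of "mult M c a"] by (metis imageE)
  then have "a \<in> J" using assms by (auto simp: jacobson_radical_def)
  then show False
    using J assms unfolding maximal_modular_left_ideal_def modular_left_ideal_def left_ideal_def
    by blast
qed

end

section \<open>The bidual of a normed algebra\<close>

lemma dual_iff:
  "f \<in> carrier (dual M) \<longleftrightarrow> f \<in> extensional (carrier M) \<and>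
    (\<forall>x\<in>carrier M. \<forall>y\<in>carrier M. f (add M x y) = f x + f y) \<and>
    (\<forall>c. \<forall>x\<in>carrier M. f (scale M c x) = c * f x) \<and>
    (\<exists>K. \<forall>x\<in>carrier M. cmod (f x) \<le> K * nrm M x)"
  by (simp add: dual_def)

lemma dualI:
  assumes "f \<in> extensional (carrier M)"
    and "\<And>x y. x \<in> carrier M \<Longrightarrow> y \<in> carrier M \<Longrightarrow> f (add M x y) = f x + f y"
    and "\<And>c x. x \<in> carrier M \<Longrightarrow> f (scale M c x) = c * f x"
    and "\<And>x. x \<in> carrier M \<Longrightarrow> cmod (f x) \<le> K * nrm M x"
  shows "f \<in> carrier (dual M)"
  using assms unfolding dual_iff by blast

lemma dual_boundE:
  assumes "f \<in> carrier (dual M)"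
  obtains K where "\<And>x. x \<in> carrier M \<Longrightarrow> cmod (f x) \<le> K * nrm M x"
  using assms unfolding dual_iff by blast

lemma dual_add: "f \<in> carrier (dual M) \<Longrightarrow> x \<in> carrier M \<Longrightarrow> y \<in> carrier M \<Longrightarrow>
    f (add M x y) = f x + f y"
  and dual_scale: "f \<in> carrier (dual M) \<Longrightarrow> x \<in> carrier M \<Longrightarrow> f (scale M c x) = c * f x"
  and dual_eqI: "f \<in> carrier (dual M) \<Longrightarrow> g \<in> carrier (dual M) \<Longrightarrow>
    (\<And>x. x \<in> carrier M \<Longrightarrow> f x = g x) \<Longrightarrow> f = g"
  by (auto simp: dual_iff intro: extensionalityI)

lemma dual_ops_apply:
  "x \<in> carrier M \<Longrightarrow> add (dual M) f g x = f x + g x"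
  "x \<in> carrier M \<Longrightarrow> scale (dual M) c f x = c * f x"
  "x \<in> carrier M \<Longrightarrow> zero (dual M) x = 0"
  by (simp_all add: dual_def)

lemma dual_add_closed:
  assumes "\<And>x y. x \<in> carrier M \<Longrightarrow> y \<in> carrier M \<Longrightarrow> add M x y \<in> carrier M"
    and "\<And>c x. x \<in> carrier M \<Longrightarrow> scale M c x \<in> carrier M"
    and f: "f \<in> carrier (dual M)" and g: "g \<in> carrier (dual M)"
  shows "add (dual M) f g \<in> carrier (dual M)"
proof -
  obtain K where "\<And>x. x \<in> carrier M \<Longrightarrow> cmod (f x) \<le> K * nrm M x"
    using f by (rule dual_boundE) blast
  moreover obtain K' where "\<And>x. x \<in> carrier M \<Longrightarrow> cmod (g x) \<le> K' * nrm M x"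
    using g by (rule dual_boundE) blast
  ultimately have "cmod (f x + g x) \<le> (K + K') * nrm M x" if "x \<in> carrier M" for x
    using that by (auto simp: distrib_right intro!: norm_triangle_le add_mono)
  moreover have "add (dual M) f g \<in> extensional (carrier M)" by (simp add: dual_def)
  ultimately show ?thesis
    using assms(1,2) dual_add[OF f] dual_add[OF g] dual_scale[OF f] dual_scale[OF g]
    by (intro dualI[where K = "K + K'"]) (auto simp: dual_ops_apply algebra_simps)
qed

lemma dual_scale_closed:
  assumes "\<And>x y. x \<in> carrier M \<Longrightarrow> y \<in> carrier M \<Longrightarrow> add M x y \<in> carrier M"
    and "\<And>c x. x \<in> carrier M \<Longrightarrow> scale M c x \<in> carrier M"
    and f: "f \<in> carrier (dual M)"
  shows "scale (dual M) c f \<in> carrier (dual M)"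
proof -
  obtain K where "\<And>x. x \<in> carrier M \<Longrightarrow> cmod (f x) \<le> K * nrm M x"
    using f by (rule dual_boundE) blast
  then have "cmod (c * f x) \<le> (cmod c * K) * nrm M x" if "x \<in> carrier M" for x
    using that by (auto simp: norm_mult mult.assoc intro!: mult_left_mono)
  moreover have "scale (dual M) c f \<in> extensional (carrier M)" by (simp add: dual_def)
  ultimately show ?thesis
    using assms(1,2) dual_add[OF f] dual_scale[OF f]
    by (intro dualI[where K = "cmod c * K"]) (auto simp: dual_ops_apply algebra_simps)
qed

lemma dual_zero_closed:
  assumes "\<And>x y. x \<in> carrier M \<Longrightarrow> y \<in> carrier M \<Longrightarrow> add M x y \<in> carrier M"
    and "\<And>c x. x \<in> carrier M \<Longrightarrow> scale M c x \<in> carrier M"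
  shows "zero (dual M) \<in> carrier (dual M)"
proof -
  have "zero (dual M) \<in> extensional (carrier M)" by (simp add: dual_def)
  then show ?thesis
    using assms by (intro dualI[where K = 0]) (auto simp: dual_ops_apply)
qed

locale complex_normed_algebra = complex_algebra +
  assumes nrm_nonneg: "x \<in> carrier M \<Longrightarrow> nrm M x \<ge> 0"
    and nrm_scale: "x \<in> carrier M \<Longrightarrow> nrm M (scale M c x) = cmod c * nrm M x"
    and nrm_mult: "x \<in> carrier M \<Longrightarrow> y \<in> carrier M \<Longrightarrow> nrm M (mult M x y) \<le> nrm M x * nrm M y"
begin

lemma nrm_zero: "nrm M (zero M) = 0"
  using nrm_scale[OF zero_closed, of 0] by (simp add: scale_zero zero_closed)

lemma dual_nrm_upper:
  assumes f: "f \<in> carrier (dual M)" and x: "x \<in> carrier M" "nrm M x \<le> 1"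
  shows "cmod (f x) \<le> nrm (dual M) f"
proof -
  obtain K where K: "\<And>x. x \<in> carrier M \<Longrightarrow> cmod (f x) \<le> K * nrm M x"
    using f by (rule dual_boundE) blast
  have "bdd_above ((\<lambda>x. cmod (f x)) ` {x \<in> carrier M. nrm M x \<le> 1})"
  proof (rule bdd_aboveI2)
    fix z assume z: "z \<in> {x \<in> carrier M. nrm M x \<le> 1}"
    then have "cmod (f z) \<le> \<bar>K\<bar> * nrm M z"
      using K[of z] nrm_nonneg[of z] by (smt (verit) mem_Collect_eq mult_right_mono)
    also have "\<dots> \<le> \<bar>K\<bar> * 1" using z by (intro mult_left_mono) auto
    finally show "cmod (f z) \<le> \<bar>K\<bar>" by simp
  qed
  then show ?thesis
    using x by (auto simp: dual_def intro!: cSUP_upper)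
qed

lemma dual_nrm_nonneg: "f \<in> carrier (dual M) \<Longrightarrow> nrm (dual M) f \<ge> 0"
  using dual_nrm_upper[of f "zero M"] zero_closed nrm_zero
  by (metis norm_ge_zero order_trans zero_le_one)

lemma dual_nrm_bound:
  assumes f: "f \<in> carrier (dual M)" and x: "x \<in> carrier M"
  shows "cmod (f x) \<le> nrm (dual M) f * nrm M x"
proof (cases "nrm M x = 0")
  case True
  obtain K where "cmod (f x) \<le> K * nrm M x"
    using f x by (metis dual_boundE)
  with True show ?thesis by simp
next
  case False
  define y where "y = scale M (of_real (inverse (nrm M x))) x"
  have pos: "nrm M x > 0" using False nrm_nonneg[OF x] by simp
  have y: "y \<in> carrier M" "nrm M y = 1"
    using x pos by (simp_all add: y_def closed nrm_scale norm_inverse del: of_real_inverse)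
  have "cmod (f y) \<le> nrm (dual M) f"
    using f y by (intro dual_nrm_upper) auto
  moreover have "cmod (f y) = inverse (nrm M x) * cmod (f x)"
    using f x pos by (simp add: y_def dual_scale norm_mult norm_inverse del: of_real_inverse)
  ultimately show ?thesis using pos
    by (simp add: field_simps)
qed

lemma dual_nrm_le:
  assumes "K \<ge> 0" and "\<And>x. x \<in> carrier M \<Longrightarrow> cmod (f x) \<le> K * nrm M x"
  shows "nrm (dual M) f \<le> K"
proof -
  have "(SUP x\<in>{x \<in> carrier M. nrm M x \<le> 1}. cmod (f x)) \<le> K"
  proof (rule cSUP_least)
    show "{x \<in> carrier M. nrm M x \<le> 1} \<noteq> {}"
      using zero_closed nrm_zero by auto
    fix x assume x: "x \<in> {x \<in> carrier M. nrm M x \<le> 1}"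
    then have "K * nrm M x \<le> K * 1" using assms(1) by (intro mult_left_mono) auto
    then show "cmod (f x) \<le> K" using assms(2)[of x] x by auto
  qed
  then show ?thesis by (simp add: dual_def)
qed

lemma dual_closed:
  "f \<in> carrier (dual M) \<Longrightarrow> g \<in> carrier (dual M) \<Longrightarrow> add (dual M) f g \<in> carrier (dual M)"
  "f \<in> carrier (dual M) \<Longrightarrow> scale (dual M) c f \<in> carrier (dual M)"
  "zero (dual M) \<in> carrier (dual M)"
  by (intro dual_add_closed dual_scale_closed dual_zero_closed closed; assumption)+

text \<open>These are the functionals \<open>f \<cdot> a\<close> and \<open>G \<cdot> f\<close> from which the first Arens product is
  built.\<close>

definition translate :: "('a \<Rightarrow> complex) \<Rightarrow> 'a \<Rightarrow> 'a \<Rightarrow> complex" where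
  "translate f a = (\<lambda>b\<in>carrier M. f (mult M a b))"

definition bidual_action :: "(('a \<Rightarrow> complex) \<Rightarrow> complex) \<Rightarrow> ('a \<Rightarrow> complex) \<Rightarrow> 'a \<Rightarrow> complex" where
  "bidual_action G f = (\<lambda>a\<in>carrier M. G (translate f a))"

lemma arens_product_apply:
  "f \<in> carrier (dual M) \<Longrightarrow> arens_product M F G f = F (bidual_action G f)"
  by (simp add: arens_product_def bidual_action_def translate_def)

lemma translate_bound:
  assumes f: "f \<in> carrier (dual M)" and a: "a \<in> carrier M" and b: "b \<in> carrier M"
  shows "cmod (translate f a b) \<le> nrm (dual M) f * nrm M a * nrm M b"
proof -
  have "cmod (translate f a b) \<le> nrm (dual M) f * nrm M (mult M a b)"
    using assms by (simp add: translate_def dual_nrm_bound closed)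
  also have "\<dots> \<le> nrm (dual M) f * (nrm M a * nrm M b)"
    using assms by (intro mult_left_mono nrm_mult dual_nrm_nonneg)
  finally show ?thesis by (simp add: mult.assoc)
qed

lemma translate_closed:
  assumes f: "f \<in> carrier (dual M)" and a: "a \<in> carrier M"
  shows "translate f a \<in> carrier (dual M)"
proof -
  have "translate f a \<in> extensional (carrier M)" by (simp add: translate_def)
  then show ?thesis
    by (rule dualI[OF _ _ _ translate_bound[OF f a]])
       (use f a in \<open>simp_all add: translate_def closed mult_add_right mult_scale_right dual_add dual_scale\<close>)
qed

lemma nrm_translate:
  assumes "f \<in> carrier (dual M)" and "a \<in> carrier M"
  shows "nrm (dual M) (translate f a) \<le> nrm (dual M) f * nrm M a"
  using assms by (intro dual_nrm_le translate_bound mult_nonneg_nonneg dual_nrm_nonneg nrm_nonneg)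

lemma bidual_bound:
  assumes "G \<in> carrier (dual (dual M))"
  obtains K where "K \<ge> 0" "\<And>f. f \<in> carrier (dual M) \<Longrightarrow> cmod (G f) \<le> K * nrm (dual M) f"
proof -
  obtain K where K: "\<And>f. f \<in> carrier (dual M) \<Longrightarrow> cmod (G f) \<le> K * nrm (dual M) f"
    using assms by (rule dual_boundE) blast
  have "cmod (G f) \<le> \<bar>K\<bar> * nrm (dual M) f" if "f \<in> carrier (dual M)" for f
    using K[OF that] dual_nrm_nonneg[OF that] by (smt (verit) mult_right_mono)
  then show thesis using that[of "\<bar>K\<bar>"] by simp
qed

lemma bidual_action_bound:
  assumes K: "K \<ge> 0" "\<And>f. f \<in> carrier (dual M) \<Longrightarrow> cmod (G f) \<le> K * nrm (dual M) f"
    and f: "f \<in> carrier (dual M)" and a: "a \<in> carrier M"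
  shows "cmod (bidual_action G f a) \<le> K * nrm (dual M) f * nrm M a"
proof -
  have "cmod (bidual_action G f a) \<le> K * nrm (dual M) (translate f a)"
    using f a by (simp add: bidual_action_def K translate_closed)
  also have "\<dots> \<le> K * (nrm (dual M) f * nrm M a)"
    using f a K(1) by (intro mult_left_mono nrm_translate)
  finally show ?thesis by (simp add: mult.assoc)
qed

lemma translate_ops:
  assumes f: "f \<in> carrier (dual M)" and a: "a \<in> carrier M" "b \<in> carrier M"
  shows "translate f (add M a b) = add (dual M) (translate f a) (translate f b)"
    and "translate f (scale M c a) = scale (dual M) c (translate f a)"
  by (rule dual_eqI[where M = M];
      use assms in \<open>simp add: translate_closed closed dual_closed dual_ops_apply\<close>;
      use assms in \<open>simp add: translate_def closed mult_add_left mult_scale_left mult_assoc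
        dual_add dual_scale\<close>)+

lemma translate_translate:
  assumes "f \<in> carrier (dual M)" "a \<in> carrier M" "b \<in> carrier M"
  shows "translate (translate f a) b = translate f (mult M a b)"
  by (rule dual_eqI[where M = M])
     (use assms in \<open>simp_all add: translate_closed closed\<close>,
      use assms in \<open>simp add: translate_def closed mult_assoc\<close>)

lemma translate_linear:
  assumes f: "f \<in> carrier (dual M)" "g \<in> carrier (dual M)" and a: "a \<in> carrier M"
  shows "translate (add (dual M) f g) a = add (dual M) (translate f a) (translate g a)"
    and "translate (scale (dual M) c f) a = scale (dual M) c (translate f a)"
  by (rule dual_eqI[where M = M];
      use assms in \<open>simp add: translate_closed closed dual_closed dual_ops_apply\<close>;
      use assms in \<open>simp add: translate_def closed dual_ops_apply\<close>)+

lemma bidual_action_closed: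
  assumes G: "G \<in> carrier (dual (dual M))" and f: "f \<in> carrier (dual M)"
  shows "bidual_action G f \<in> carrier (dual M)"
proof -
  obtain K where K: "K \<ge> 0" "\<And>f. f \<in> carrier (dual M) \<Longrightarrow> cmod (G f) \<le> K * nrm (dual M) f"
    using bidual_bound[OF G] by blast
  have "bidual_action G f \<in> extensional (carrier M)" by (simp add: bidual_action_def)
  then show ?thesis
    by (rule dualI[OF _ _ _ bidual_action_bound[OF K f]])
       (use f in \<open>simp_all add: bidual_action_def closed translate_ops translate_closed
          dual_add[OF G] dual_scale[OF G]\<close>)
qed

lemma bidual_closed:
  "F \<in> carrier (dual (dual M)) \<Longrightarrow> G \<in> carrier (dual (dual M)) \<Longrightarrow>
    add (dual (dual M)) F G \<in> carrier (dual (dual M))"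
  "F \<in> carrier (dual (dual M)) \<Longrightarrow> scale (dual (dual M)) c F \<in> carrier (dual (dual M))"
  "zero (dual (dual M)) \<in> carrier (dual (dual M))"
  by (intro dual_add_closed dual_scale_closed dual_zero_closed dual_closed; assumption)+

lemma bidual_action_linear:
  assumes G: "G \<in> carrier (dual (dual M))" and f: "f \<in> carrier (dual M)" "g \<in> carrier (dual M)"
  shows "bidual_action G (add (dual M) f g) = add (dual M) (bidual_action G f) (bidual_action G g)"
    and "bidual_action G (scale (dual M) c f) = scale (dual M) c (bidual_action G f)"
  by (rule dual_eqI[where M = M];
      use assms in \<open>simp add: bidual_action_closed dual_closed dual_ops_apply\<close>;
      use assms in \<open>simp add: bidual_action_def translate_linear translate_closed
        dual_add[OF G] dual_scale[OF G]\<close>)+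

lemma arens_product_closed:
  assumes F: "F \<in> carrier (dual (dual M))" and G: "G \<in> carrier (dual (dual M))"
  shows "arens_product M F G \<in> carrier (dual (dual M))"
proof -
  obtain K where K: "K \<ge> 0" "\<And>f. f \<in> carrier (dual M) \<Longrightarrow> cmod (F f) \<le> K * nrm (dual M) f"
    using bidual_bound[OF F] by blast
  obtain L where L: "L \<ge> 0" "\<And>f. f \<in> carrier (dual M) \<Longrightarrow> cmod (G f) \<le> L * nrm (dual M) f"
    using bidual_bound[OF G] by blast
  have "cmod (arens_product M F G f) \<le> K * L * nrm (dual M) f" if f: "f \<in> carrier (dual M)" for f
  proof -
    have "cmod (F (bidual_action G f)) \<le> K * nrm (dual M) (bidual_action G f)"
      by (intro K bidual_action_closed G f)
    also have "\<dots> \<le> K * (L * nrm (dual M) f)"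
      using K L f by (intro mult_left_mono dual_nrm_le bidual_action_bound mult_nonneg_nonneg dual_nrm_nonneg)
    finally show ?thesis using f by (simp add: arens_product_apply mult.assoc)
  qed
  note bound = this
  have "arens_product M F G \<in> extensional (carrier (dual M))"
    by (simp add: arens_product_def)
  then show ?thesis
    by (rule dualI[OF _ _ _ bound])
       (use G in \<open>simp_all add: arens_product_apply dual_closed
          bidual_action_linear bidual_action_closed dual_add[OF F] dual_scale[OF F]\<close>)
qed

text \<open>\<open>G \<mapsto> G \<cdot> f\<close> turns the Arens product into composition of operators on the dual, which
  is why the Arens product is associative.\<close>

lemma bidual_action_ops:
  assumes f: "f \<in> carrier (dual M)"
    and G: "G \<in> carrier (dual (dual M))" and H: "H \<in> carrier (dual (dual M))"
  shows "bidual_action (add (dual (dual M)) G H) f = add (dual M) (bidual_action G f) (bidual_action H f)"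
    and "bidual_action (scale (dual (dual M)) c G) f = scale (dual M) c (bidual_action G f)"
    and "bidual_action (arens_product M G H) f = bidual_action G (bidual_action H f)"
proof -
  show "bidual_action (add (dual (dual M)) G H) f = add (dual M) (bidual_action G f) (bidual_action H f)"
    by (rule dual_eqI[where M = M])
       (use assms in \<open>auto simp: bidual_action_closed dual_closed bidual_closed dual_ops_apply\<close>,
        use assms in \<open>auto simp: bidual_action_def dual_ops_apply translate_closed\<close>)
  show "bidual_action (scale (dual (dual M)) c G) f = scale (dual M) c (bidual_action G f)"
    by (rule dual_eqI[where M = M])
       (use assms in \<open>auto simp: bidual_action_closed dual_closed bidual_closed dual_ops_apply\<close>,
        use assms in \<open>auto simp: bidual_action_def dual_ops_apply translate_closed\<close>)
  have "translate (bidual_action H f) a = bidual_action H (translate f a)" if a: "a \<in> carrier M" for a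
  proof (rule dual_eqI[where M = M])
    fix b assume b: "b \<in> carrier M"
    then have "translate (bidual_action H f) a b = bidual_action H f (mult M a b)"
      by (simp add: translate_def)
    also have "\<dots> = bidual_action H (translate f a) b"
      using a b f by (simp add: bidual_action_def closed translate_translate)
    finally show "translate (bidual_action H f) a b = bidual_action H (translate f a) b" .
  qed (use a f H in \<open>auto intro!: translate_closed bidual_action_closed\<close>)
  then show "bidual_action (arens_product M G H) f = bidual_action G (bidual_action H f)"
    using f by (auto simp: bidual_action_def[of "arens_product M G H"] bidual_action_def[of G]
        arens_product_apply translate_closed intro!: restrict_ext)
qed

lemma bidual_simps:
  "carrier (bidual M) = carrier (dual (dual M))" "add (bidual M) = add (dual (dual M))"
  "zero (bidual M) = zero (dual (dual M))" "scale (bidual M) = scale (dual (dual M))"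
  "mult (bidual M) = arens_product M"
  by (simp_all add: bidual_def)

lemma complex_algebra_bidual: "complex_algebra (bidual M)"
  by (unfold_locales, unfold bidual_simps)
     (auto intro!: dual_eqI[where M = "dual M"]
       simp: bidual_closed arens_product_closed dual_ops_apply arens_product_apply
      bidual_action_closed bidual_action_ops dual_closed algebra_simps dual_add dual_scale)

lemma canonical_apply: "f \<in> carrier (dual M) \<Longrightarrow> canonical M a f = f a"
  by (simp add: canonical_def)

lemma canonical_closed:
  assumes "a \<in> carrier M"
  shows "canonical M a \<in> carrier (dual (dual M))"
proof -
  have ext: "canonical M a \<in> extensional (carrier (dual M))"
    unfolding canonical_def by (rule restrict_extensional)
  have "cmod (canonical M a f) \<le> nrm M a * nrm (dual M) f" if "f \<in> carrier (dual M)" for f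
    using that assms dual_nrm_bound[of f a] by (simp add: canonical_def mult.commute)
  then show ?thesis
    by (rule dualI[rotated -1])
       (use assms ext in \<open>simp_all add: canonical_apply dual_closed dual_ops_apply\<close>)
qed

end


section \<open>Maximal modular left ideals of operator algebras\<close>

lemma complex_normed_algebra_operator_algebra:
  assumes "subalgebra B"
  shows "complex_normed_algebra (operator_algebra B)"
  by unfold_locales
     (simp_all add: subalgebra_closed_ops[OF assms] op_scale_simps compose_simps norm_op_scale
       norm_blinfun_compose)

lemma left_ideal_operator_algebra:
  assumes "left_ideal (operator_algebra B) J"
  shows "J \<subseteq> B" "0 \<in> J" "x \<in> J \<Longrightarrow> y \<in> J \<Longrightarrow> x + y \<in> J" "x \<in> J \<Longrightarrow> op_scale c x \<in> J"
    "x \<in> J \<Longrightarrow> y \<in> J \<Longrightarrow> x - y \<in> J" "a \<in> B \<Longrightarrow> x \<in> J \<Longrightarrow> a o\<^sub>L x \<in> J"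
proof -
  show "x - y \<in> J" if "x \<in> J" "y \<in> J"
    using assms that op_scale_simps(5)[of y] unfolding left_ideal_def operator_algebra_simps
    by (metis add_uminus_conv_diff)
qed (use assms in \<open>auto simp: left_ideal_def\<close>)

lemma maximal_modular_operator_algebraE:
  assumes "maximal_modular_left_ideal (operator_algebra B) J"
  obtains u where "left_ideal (operator_algebra B) J" "u \<in> B" "\<And>a. a \<in> B \<Longrightarrow> a - (a o\<^sub>L u) \<in> J"
    "J \<noteq> B" "\<And>J'. left_ideal (operator_algebra B) J' \<Longrightarrow> J \<subseteq> J' \<Longrightarrow> J' \<noteq> J \<Longrightarrow> J' = B" "u \<notin> J"
proof -
  obtain u where u: "u \<in> B" "\<And>a. a \<in> B \<Longrightarrow> a - (a o\<^sub>L u) \<in> J"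
    and J: "left_ideal (operator_algebra B) J" "J \<noteq> B"
    and max: "\<And>J'. left_ideal (operator_algebra B) J' \<Longrightarrow> J \<subseteq> J' \<Longrightarrow> J' \<noteq> J \<Longrightarrow> J' = B"
    using assms unfolding maximal_modular_left_ideal_def modular_left_ideal_def
    by (auto simp: op_scale_simps)
  have "u \<notin> J"
  proof
    assume "u \<in> J"
    have "a \<in> J" if "a \<in> B" for a
      using left_ideal_operator_algebra(3)[OF J(1) u(2)[OF that] left_ideal_operator_algebra(6)[OF J(1) that \<open>u \<in> J\<close>]]
      by simp
    then show False using J left_ideal_operator_algebra(1)[OF J(1)] by blast
  qed
  then show thesis using that u J max by blast
qed

text \<open>If \<open>x = u - j\<close> has norm below 1, the Neumann series \<open>y = x + x\<^sup>2 + x\<^sup>3 + \<dots>\<close> satisfies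
  \<open>y - yx = x\<close>. Every \<open>z\<close> then equals \<open>w - wx = (w - wu) + wj\<close> for \<open>w = z + zy\<close>, and both
  summands are in the ideal.\<close>

lemma left_ideal_near_modular_unit:
  assumes B: "subalgebra B" "closed B" and J: "left_ideal (operator_algebra B) J"
    and u: "u \<in> B" "\<And>a. a \<in> B \<Longrightarrow> a - (a o\<^sub>L u) \<in> J" and j: "j \<in> J" "norm (u - j) < 1"
  shows "J = B"
proof -
  note B' = subalgebra_closed_ops[OF B(1)] and J' = left_ideal_operator_algebra[OF J]
  define x where "x = u - j"
  have x: "x \<in> B" "norm x < 1" using u j J' B' by (auto simp: x_def)
  define p where "p = rec_nat x (\<lambda>_ z. z o\<^sub>L x)"
  have p: "p 0 = x" "p (Suc n) = p n o\<^sub>L x" for n by (simp_all add: p_def)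
  have pB: "p n \<in> B" for n by (induction n) (simp_all add: p x B')
  have "norm (p n) \<le> norm x * norm x ^ n" for n
  proof (induction n)
    case (Suc n)
    have "norm (p (Suc n)) \<le> norm (p n) * norm x" by (simp add: p norm_blinfun_compose)
    also have "\<dots> \<le> norm x * norm x ^ n * norm x" using Suc by (intro mult_right_mono) auto
    finally show ?case by (simp add: mult_ac)
  qed (simp add: p)
  moreover have "summable (\<lambda>n. norm x * norm x ^ n)"
    using x by (intro summable_mult summable_geometric) simp
  ultimately have sum: "summable p" by (rule summable_comparison_test'[where N = 0, rotated])
  define y where "y = suminf p"
  have partial: "(\<Sum>i<n. p i) \<in> B" for n by (induction n) (simp_all add: pB B')
  have yB: "y \<in> B"
    unfolding y_def by (rule closed_sequentially[OF B(2) partial summable_LIMSEQ[OF sum]])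
  have "y o\<^sub>L x = (\<Sum>n. p n o\<^sub>L x)"
    unfolding y_def
    by (rule bounded_linear.suminf[OF bounded_bilinear.bounded_linear_left
          [OF bounded_bilinear_blinfun_compose] sum])
  also have "\<dots> = y - x"
    unfolding y_def using suminf_split_head[OF sum] by (simp add: p)
  finally have yx: "y o\<^sub>L x = y - x" .
  have "z \<in> J" if z: "z \<in> B" for z
  proof -
    define w where "w = z + (z o\<^sub>L y)"
    have w: "w \<in> B" using z yB B' by (simp add: w_def)
    have "w - (w o\<^sub>L x) = z"
      by (simp add: w_def compose_simps yx)
    moreover have "w - (w o\<^sub>L x) = (w - (w o\<^sub>L u)) + (w o\<^sub>L j)"
      by (simp add: x_def compose_simps)
    ultimately show ?thesis using u(2)[OF w] J'(6)[OF w j(1)] J'(3) by metis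
  qed
  then show ?thesis using J'(1) by blast
qed

text \<open>The closure of \<open>J\<close> is again a left ideal, and by the previous lemma it avoids the modular
  unit, so maximality gives equality.\<close>

lemma closed_maximal_modular_left_ideal:
  assumes B: "subalgebra B" "closed B" and max: "maximal_modular_left_ideal (operator_algebra B) J"
  shows "closed J"
proof -
  obtain u where J: "left_ideal (operator_algebra B) J"
    and u: "u \<in> B" "\<And>a. a \<in> B \<Longrightarrow> a - (a o\<^sub>L u) \<in> J"
    and proper: "J \<noteq> B" and max: "\<And>J'. left_ideal (operator_algebra B) J' \<Longrightarrow> J \<subseteq> J' \<Longrightarrow> J' \<noteq> J \<Longrightarrow> J' = B"
    using max by (elim maximal_modular_operator_algebraE) blast
  note J' = left_ideal_operator_algebra[OF J]
  have "left_ideal (operator_algebra B) (closure J)"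
    unfolding left_ideal_def operator_algebra_simps
  proof (intro conjI ballI allI)
    show "closure J \<subseteq> B" using J'(1) B(2) by (rule closure_minimal)
    show "0 \<in> closure J" using J'(2) closure_subset by blast
    show "x + y \<in> closure J" if "x \<in> closure J" "y \<in> closure J" for x y
    proof -
      obtain s t where "\<And>n. s n \<in> J" "s \<longlonglongrightarrow> x" "\<And>n. t n \<in> J" "t \<longlonglongrightarrow> y"
        using \<open>x \<in> closure J\<close> \<open>y \<in> closure J\<close> by (auto simp: closure_sequential)
      then show ?thesis
        unfolding closure_sequential
        by (intro exI[of _ "\<lambda>n. s n + t n"] conjI allI J' tendsto_add) auto
    qed
    show "op_scale c x \<in> closure J" if x: "x \<in> closure J" for c x
    proof -
      obtain s where "\<And>n. s n \<in> J" "s \<longlonglongrightarrow> x"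
        using x by (auto simp: closure_sequential)
      then show ?thesis
        unfolding closure_sequential
        by (intro exI[of _ "\<lambda>n. op_scale c (s n)"] conjI allI J'
            bounded_linear.tendsto[OF bounded_linear_op_scale])
    qed
    show "a o\<^sub>L x \<in> closure J" if a: "a \<in> B" and x: "x \<in> closure J" for a x
    proof -
      obtain s where "\<And>n. s n \<in> J" "s \<longlonglongrightarrow> x"
        using x by (auto simp: closure_sequential)
      then show ?thesis
        unfolding closure_sequential
        by (intro exI[of _ "\<lambda>n. a o\<^sub>L s n"] conjI allI J' a
            bounded_bilinear.tendsto[OF bounded_bilinear_blinfun_compose tendsto_const])
    qed
  qed
  moreover have "closure J \<noteq> B"
  proof
    assume "closure J = B"
    then obtain j where "j \<in> J" "dist j u < 1"
      using u(1) unfolding closure_approachable[of u J, symmetric]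
      by (metis closure_approachable zero_less_one)
    then show False
      using left_ideal_near_modular_unit[OF B J u] proper by (simp add: dist_norm norm_minus_commute)
  qed
  ultimately have "closure J = J" using max closure_subset by metis
  then show ?thesis by (metis closed_closure)
qed

text \<open>Otherwise \<open>J\<close> and \<open>t\<close> together generate \<open>B\<close>, and the modular unit has the form
  \<open>u = j + n\<close> where \<open>n\<close> lies in the left ideal generated by \<open>t\<close>. Then \<open>nn = 0\<close>, so that
  \<open>n = n - nn = (n - nu) + nj\<close> is in \<open>J\<close>, and so is \<open>u\<close>.\<close>

lemma square_zero_in_maximal_modular_left_ideal:
  assumes B: "subalgebra B" and max: "maximal_modular_left_ideal (operator_algebra B) J"
    and t: "t \<in> B" "t o\<^sub>L t = 0" "\<And>a. a \<in> B \<Longrightarrow> t o\<^sub>L a o\<^sub>L t = 0"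
  shows "t \<in> J"
proof (rule ccontr)
  assume "t \<notin> J"
  obtain u where J: "left_ideal (operator_algebra B) J"
    and u: "u \<in> B" "\<And>a. a \<in> B \<Longrightarrow> a - (a o\<^sub>L u) \<in> J" "u \<notin> J"
    and max: "\<And>J'. left_ideal (operator_algebra B) J' \<Longrightarrow> J \<subseteq> J' \<Longrightarrow> J' \<noteq> J \<Longrightarrow> J' = B"
    using max by (elim maximal_modular_operator_algebraE) blast
  note J' = left_ideal_operator_algebra[OF J] and B' = subalgebra_closed_ops[OF B]
  define N where "N = {op_scale c t + (a o\<^sub>L t) |c a. a \<in> B}"
  have NB: "N \<subseteq> B" using t B' by (auto simp: N_def)
  have N0: "n o\<^sub>L n = 0" if n: "n \<in> N" for n
  proof -
    obtain c a where n: "n = op_scale c t + (a o\<^sub>L t)" "a \<in> B"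
      using n unfolding N_def by blast
    have "t o\<^sub>L n = 0"
      using n t B' by (simp add: compose_simps op_scale_simps flip: compose_simps(7))
        (simp add: op_scale_simps blinfun_eqI)
    then show ?thesis
      using n(1) by (metis add.right_neutral compose_simps(1,5,7,9) op_scale_simps(3,6) mult_zero_right)
  qed
  define J1 where "J1 = {j + n |j n. j \<in> J \<and> n \<in> N}"
  have N: "0 \<in> N" "t \<in> N" "n \<in> N \<Longrightarrow> n' \<in> N \<Longrightarrow> n + n' \<in> N" "n \<in> N \<Longrightarrow> op_scale c n \<in> N"
    "a \<in> B \<Longrightarrow> n \<in> N \<Longrightarrow> a o\<^sub>L n \<in> N" for n n' c a
  proof -
    show "0 \<in> N" unfolding N_def using B'
      by (intro CollectI exI[of _ 0]) (simp add: op_scale_simps compose_simps)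
    show "t \<in> N" unfolding N_def using B'
      by (intro CollectI exI[of _ 1] exI[of _ 0]) (simp add: op_scale_simps compose_simps)
    show "n + n' \<in> N" if nn: "n \<in> N" "n' \<in> N"
    proof -
      obtain c a c' a' where "n = op_scale c t + (a o\<^sub>L t)" "a \<in> B" "n' = op_scale c' t + (a' o\<^sub>L t)" "a' \<in> B"
        using nn by (auto simp: N_def)
      then show ?thesis unfolding N_def
        by (intro CollectI exI[of _ "c + c'"] exI[of _ "a + a'"]) (simp add: op_scale_simps compose_simps B')
    qed
    show "op_scale c n \<in> N" if nn: "n \<in> N"
    proof -
      obtain d a where "n = op_scale d t + (a o\<^sub>L t)" "a \<in> B"
        using nn by (auto simp: N_def)
      then show ?thesis unfolding N_def
        by (intro CollectI exI[of _ "c * d"] exI[of _ "op_scale c a"]) (simp add: op_scale_simps compose_simps B')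
    qed
    show "a o\<^sub>L n \<in> N" if a: "a \<in> B" and nn: "n \<in> N"
    proof -
      obtain d a' where "n = op_scale d t + (a' o\<^sub>L t)" "a' \<in> B"
        using nn by (auto simp: N_def)
      then show ?thesis unfolding N_def using a B'(7)[OF a]
        by (intro CollectI exI[of _ 0] exI[of _ "op_scale d a + (a o\<^sub>L a')"])
           (simp add: op_scale_simps compose_simps B')
    qed
  qed
  have "left_ideal (operator_algebra B) J1"
    unfolding left_ideal_def operator_algebra_simps
  proof (intro conjI ballI allI)
    show "J1 \<subseteq> B" using J'(1) NB B'(3) by (fastforce simp: J1_def)
    show "0 \<in> J1" unfolding J1_def using J'(2) N(1) by force
    show "x + y \<in> J1" if xy: "x \<in> J1" "y \<in> J1" for x y
    proof -
      obtain j n j' n' where "x = j + n" "y = j' + n'" "j \<in> J" "j' \<in> J" "n \<in> N" "n' \<in> N"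
        using xy by (auto simp: J1_def)
      then show ?thesis unfolding J1_def using J' N
        by (intro CollectI exI[of _ "j + j'"] exI[of _ "n + n'"]) simp
    qed
    show "op_scale c x \<in> J1" if "x \<in> J1" for c x
      using that J'(4) N(4) by (fastforce simp: J1_def op_scale_simps)
    show "a o\<^sub>L x \<in> J1" if "a \<in> B" "x \<in> J1" for a x
      using that J'(6) N(5) by (fastforce simp: J1_def compose_simps)
  qed
  moreover have "J \<subseteq> J1" unfolding J1_def using N(1) by force
  moreover have "t \<in> J1" unfolding J1_def using N(2) J'(2) by force
  ultimately have "u \<in> J1" using max \<open>t \<notin> J\<close> u(1) by blast
  then obtain j n where jn: "u = j + n" "j \<in> J" "n \<in> N" by (auto simp: J1_def)
  then have n: "n \<in> B" "n o\<^sub>L n = 0" using NB N0 by auto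
  have "n = (n - (n o\<^sub>L u)) + (n o\<^sub>L j)"
    using n by (simp add: jn(1) compose_simps)
  then have "n \<in> J" using u(2)[OF n(1)] J'(3) J'(6)[OF n(1) jn(2)] by metis
  then show False using J'(3) jn u(3) by blast
qed

lemma dual_operator_algebra_sum:
  assumes B: "subalgebra B" and f: "f \<in> carrier (dual (operator_algebra B))"
    and g: "\<And>i. i \<in> S \<Longrightarrow> g i \<in> B" and "finite S"
  shows "sum g S \<in> B \<and> f (sum g S) = (\<Sum>i\<in>S. f (g i))"
  using \<open>finite S\<close> g
proof (induction S rule: finite_induct)
  case empty
  have "f (op_scale 0 0) = 0 * f 0"
    using dual_scale[OF f, of 0 0] subalgebra_closed_ops(2)[OF B] by simp
  then show ?case using subalgebra_closed_ops[OF B] by (simp add: op_scale_simps)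
next
  case (insert i S)
  then show ?case
    using dual_add[OF f, of "g i" "sum g S"] subalgebra_closed_ops(3)[OF B] by simp
qed


section \<open>The radical of the generated algebra\<close>

locale ladder =
  fixes e :: "nat \<Rightarrow> 'h::chilbert_space" and T :: "nat \<Rightarrow> 'h \<Rightarrow>\<^sub>L 'h"
  assumes basis: "orthonormal_basis e {1..}"
    and T_bounded: "\<And>n. T n \<in> bounded_ops"
    and T_zero: "\<And>i. i \<ge> 1 \<Longrightarrow> T 0 (e i) = (if odd i then e (i + 1) else 0)"
    and T_pos: "\<And>n i. n \<ge> 1 \<Longrightarrow> i \<ge> 1 \<Longrightarrow> T n (e i) = (if i = 2 * n then e (2 * n + 1) else 0)"
begin

definition C :: "('h \<Rightarrow>\<^sub>L 'h) set" where
  "C = closed_subalgebra_generated (range T)"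

lemma subalgebra_C: "subalgebra C" and closed_C: "closed C" and T_in_C: "T n \<in> C"
  and C_least: "subalgebra B \<Longrightarrow> closed B \<Longrightarrow> (\<And>n. T n \<in> B) \<Longrightarrow> C \<subseteq> B"
proof -
  have "range T \<subseteq> bounded_ops" using T_bounded by auto
  note * = closed_subalgebra_generated[OF this, folded C_def]
  show "subalgebra C" "closed C" "T n \<in> C" using *(1-3) by auto
  show "C \<subseteq> B" if "subalgebra B" "closed B" "\<And>n. T n \<in> B"
    using *(4)[OF that(1,2)] that(3) by auto
qed

lemmas C_closed_ops = subalgebra_closed_ops[OF subalgebra_C]

lemma cinner_e: "i \<ge> 1 \<Longrightarrow> j \<ge> 1 \<Longrightarrow> cinner (e i) (e j) = (if i = j then 1 else 0)"
  using basis by (auto simp: orthonormal_basis_def)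

lemma basis_induct:
  assumes "complex_space.subspace {x. P x}" "closed {x. P x}" "\<And>i. i \<ge> 1 \<Longrightarrow> P (e i)"
  shows "P x"
proof -
  have "{x. P x} = UNIV"
    by (rule closed_subspace_eq_UNIV[OF basis assms(1,2)]) (simp add: assms(3))
  then show ?thesis by auto
qed

lemma T_apply:
  assumes "n \<ge> 1"
  shows "T n x = cinner x (e (2 * n)) *\<^sub>C e (2 * n + 1)"
proof (rule basis_induct[where P = "\<lambda>x. T n x = cinner x (e (2 * n)) *\<^sub>C e (2 * n + 1)"])
  show "complex_space.subspace {x. T n x = cinner x (e (2 * n)) *\<^sub>C e (2 * n + 1)}"
    by (auto simp: complex_space.subspace_def blinfun.add_right bounded_opsD[OF T_bounded]
        cinner_add_left cinner_cscale_left cscale_add_left cscale_cscale)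
  show "closed {x. T n x = cinner x (e (2 * n)) *\<^sub>C e (2 * n + 1)}"
    by (intro closed_Collect_eq continuous_intros
        bounded_linear.continuous_on[OF bounded_linear_cscale_left])
qed (use assms in \<open>simp add: T_pos cinner_e cscale_one\<close>)

lemma T_zero_square: "T 0 o\<^sub>L T 0 = 0"
proof (rule blinfun_eqI)
  fix x
  have "T 0 (T 0 x) = 0"
  proof (rule basis_induct[where P = "\<lambda>x. T 0 (T 0 x) = 0"])
    show "complex_space.subspace {x. T 0 (T 0 x) = 0}"
      by (auto simp: complex_space.subspace_def blinfun.add_right bounded_opsD[OF T_bounded])
    show "closed {x. T 0 (T 0 x) = 0}"
      by (intro closed_Collect_eq continuous_intros)
  qed (simp add: T_zero)
  then show "blinfun_apply (T 0 o\<^sub>L T 0) x = blinfun_apply 0 x" by simp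
qed

lemma cinner_T_zero:
  assumes "j \<ge> 1"
  shows "cinner (T 0 x) (e j) = (if even j then cinner x (e (j - 1)) else 0)"
proof (rule basis_induct[where P = "\<lambda>x. cinner (T 0 x) (e j) = (if even j then cinner x (e (j - 1)) else 0)"])
  show "complex_space.subspace {x. cinner (T 0 x) (e j) = (if even j then cinner x (e (j - 1)) else 0)}"
    by (auto simp: complex_space.subspace_def blinfun.add_right bounded_opsD[OF T_bounded]
        cinner_add_left cinner_cscale_left)
  show "closed {x. cinner (T 0 x) (e j) = (if even j then cinner x (e (j - 1)) else 0)}"
    by (cases "even j") (auto intro!: closed_Collect_eq continuous_intros)
  show "cinner (T 0 (e i)) (e j) = (if even j then cinner (e i) (e (j - 1)) else 0)" if "i \<ge> 1" for i
    using that assms by (auto simp: T_zero cinner_e elim!: evenE oddE)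
qed

definition tail :: "nat \<Rightarrow> 'h set" where
  "tail i = {x. \<forall>j. 1 \<le> j \<and> j \<le> i \<longrightarrow> cinner x (e j) = 0}"

text \<open>The operators with this property form a closed subalgebra, and on the generators the
  property can be read off the basis.\<close>

lemma C_tail:
  assumes "a \<in> C" "x \<in> tail i"
  shows "a x \<in> tail (Suc i)"
proof -
  define L where "L = {a \<in> bounded_ops. \<forall>i. \<forall>x\<in>tail i. blinfun_apply a x \<in> tail (Suc i)}"
  have mono: "x \<in> tail i" if "x \<in> tail (Suc i)" for x i
    using that by (auto simp: tail_def)
  have "subalgebra L"
    unfolding subalgebra_def
  proof (intro conjI ballI allI)
    show "L \<subseteq> bounded_ops" by (auto simp: L_def)
    show "S o\<^sub>L S' \<in> L" if "S \<in> L" "S' \<in> L" for S S'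
      using that mono subalgebra_closed_ops(5)[OF subalgebra_bounded_ops] by (auto simp: L_def)
  qed (use subalgebra_closed_ops[OF subalgebra_bounded_ops] in
      \<open>auto simp: L_def tail_def blinfun.add_left cinner_add_left cinner_cscale_left\<close>)
  moreover have "closed L"
  proof -
    have "L = bounded_ops \<inter> (\<Inter>i. \<Inter>x\<in>tail i. \<Inter>j\<in>{1..Suc i}. {a. cinner (blinfun_apply a x) (e j) = 0})"
      by (auto simp: L_def tail_def)
    moreover have "closed {a. cinner (blinfun_apply a x) (e j) = 0}" for x :: 'h and j
      by (intro closed_Collect_eq continuous_intros)
    ultimately show ?thesis
      by (simp only:) (intro closed_Int closed_INT ballI closed_bounded_ops)
  qed
  moreover have "T n \<in> L" for n
  proof -
    have "T n x \<in> tail (Suc i)" if x: "x \<in> tail i" for i x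
    proof (cases "n = 0")
      case True
      have "1 \<le> j - 1" if "1 \<le> j" "even j" for j :: nat
        using that by presburger
      with True show ?thesis using x
        by (fastforce simp: tail_def cinner_T_zero)
    next
      case False
      then show ?thesis using x
        by (auto simp: tail_def T_apply cinner_cscale_left cinner_e)
    qed
    then show ?thesis using T_bounded by (simp add: L_def)
  qed
  ultimately have "C \<subseteq> L" by (rule C_least)
  then show ?thesis using assms by (auto simp: L_def)
qed

text \<open>The range of \<open>T n\<close> is spanned by the basis vector of index \<open>2n + 1\<close>. It is orthogonal to
  the first \<open>2n\<close> basis vectors, \<open>a\<close> preserves this, and then \<open>T n\<close> sees only a vanishing
  coefficient.\<close>

lemma T_sandwich:
  assumes "n \<ge> 1" "a \<in> C"
  shows "T n o\<^sub>L a o\<^sub>L T n = 0"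
proof (rule blinfun_eqI)
  fix x
  have "T n x \<in> tail (2 * n)"
    using assms(1) by (auto simp: tail_def T_apply cinner_cscale_left cinner_e)
  then have "cinner (a (T n x)) (e (2 * n)) = 0"
    using C_tail[OF assms(2)] assms(1) by (auto simp: tail_def)
  then show "blinfun_apply (T n o\<^sub>L a o\<^sub>L T n) x = blinfun_apply 0 x"
    using T_apply[OF assms(1), of "a (T n x)"] complex_space.scale_zero_left by simp
qed

lemma T_pos_square: "n \<ge> 1 \<Longrightarrow> T n o\<^sub>L T n = 0"
  by (rule blinfun_eqI) (simp add: T_apply cinner_cscale_left cinner_e)

text \<open>Modulo \<open>R\<close>, the largest two-sided ideal inside \<open>J\<close>, the algebra is spanned by \<open>T 0\<close>.
  Writing the modular unit as \<open>u = c T\<^sub>0 + r\<close>, one finds \<open>T\<^sub>0 u = T\<^sub>0 r \<in> J\<close>, because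
  \<open>T\<^sub>0\<^sup>2 = 0\<close>. Hence \<open>T\<^sub>0 = (T\<^sub>0 - T\<^sub>0 u) + T\<^sub>0 u\<close> is in \<open>J\<close>, and then so is \<open>u\<close>.\<close>

lemma no_maximal_modular_left_ideal: "\<not> maximal_modular_left_ideal (operator_algebra C) J"
proof
  assume max: "maximal_modular_left_ideal (operator_algebra C) J"
  have closed_J: "closed J"
    using closed_maximal_modular_left_ideal[OF subalgebra_C closed_C max] .
  obtain u where J: "left_ideal (operator_algebra C) J"
    and u: "u \<in> C" "\<And>a. a \<in> C \<Longrightarrow> a - (a o\<^sub>L u) \<in> J" "u \<notin> J"
    using max by (elim maximal_modular_operator_algebraE) blast
  note J' = left_ideal_operator_algebra[OF J]
  define R where "R = {r \<in> J. \<forall>a\<in>C. r o\<^sub>L a \<in> J}"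
  have R_zero: "0 \<in> R" using J'(2) by (simp add: R_def compose_simps)
  have R_add: "r + s \<in> R" if "r \<in> R" "s \<in> R" for r s
    using that J' by (simp add: R_def compose_simps)
  have R_scale: "op_scale c r \<in> R" if "r \<in> R" for c r
    using that J' by (simp add: R_def compose_simps)
  have R_left: "a o\<^sub>L r \<in> R" if "a \<in> C" "r \<in> R" for a r
    using that J' by (simp add: R_def compose_simps)
  have R_right: "r o\<^sub>L a \<in> R" if "a \<in> C" "r \<in> R" for a r
    using that C_closed_ops by (simp add: R_def compose_simps)
  have closed_R: "closed R"
  proof -
    have "R = J \<inter> (\<Inter>a\<in>C. (\<lambda>r. r o\<^sub>L a) -` J)" by (auto simp: R_def)
    moreover have "closed ((\<lambda>r. r o\<^sub>L a) -` J)" for a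
      by (intro closed_vimage closed_J linear_continuous_on
          bounded_bilinear.bounded_linear_left[OF bounded_bilinear_blinfun_compose])
    ultimately show ?thesis using closed_J by (simp only:) (intro closed_Int closed_INT ballI)
  qed
  have T_R: "T n \<in> R" if n: "n \<ge> 1" for n
  proof -
    have "T n \<in> J"
      by (rule square_zero_in_maximal_modular_left_ideal[OF subalgebra_C max])
         (use n in \<open>auto simp: T_in_C T_pos_square T_sandwich\<close>)
    moreover have "T n o\<^sub>L a \<in> J" if a: "a \<in> C" for a
    proof (rule square_zero_in_maximal_modular_left_ideal[OF subalgebra_C max])
      show "T n o\<^sub>L a \<in> C" using a T_in_C C_closed_ops by blast
      have eq: "T n o\<^sub>L a o\<^sub>L b o\<^sub>L (T n o\<^sub>L a) = (T n o\<^sub>L (a o\<^sub>L b) o\<^sub>L T n) o\<^sub>L a" for b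
        by (simp only: compose_simps(7))
      show "T n o\<^sub>L a o\<^sub>L (T n o\<^sub>L a) = 0"
        using T_sandwich[OF n a] by (simp add: compose_simps flip: compose_simps(7))
      show "T n o\<^sub>L a o\<^sub>L b o\<^sub>L (T n o\<^sub>L a) = 0" if b: "b \<in> C" for b
        unfolding eq using T_sandwich[OF n, of "a o\<^sub>L b"] a b C_closed_ops by (simp add: compose_simps)
    qed
    ultimately show ?thesis by (simp add: R_def)
  qed
  \<comment> \<open>A continuous functional picks out the coefficient of \<open>T 0\<close>, so that \<open>B\<close> below, which is
    the span of \<open>T 0\<close> and \<open>R\<close>, is closed.\<close>
  define \<phi> where "\<phi> a = cinner (blinfun_apply a (e 1)) (e 2)" for a :: "'h \<Rightarrow>\<^sub>L 'h"
  have \<phi>_mult: "\<phi> (a o\<^sub>L b) = 0" if "a \<in> C" "b \<in> C" for a b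
  proof -
    have "e 1 \<in> tail 0" by (simp add: tail_def)
    then have "a (b (e 1)) \<in> tail (Suc (Suc 0))" using C_tail that by blast
    then show ?thesis by (simp add: \<phi>_def tail_def)
  qed
  define B where "B = {a \<in> C. a - op_scale (\<phi> a) (T 0) \<in> R}"
  have BE: "\<exists>r\<in>R. a = op_scale (\<phi> a) (T 0) + r" if "a \<in> B" for a
    using that by (intro bexI[of _ "a - op_scale (\<phi> a) (T 0)"]) (auto simp: B_def)
  have "subalgebra B"
    unfolding subalgebra_def
  proof (intro conjI ballI allI)
    show "B \<subseteq> bounded_ops" using C_closed_ops(1) by (auto simp: B_def)
    show "0 \<in> B" using C_closed_ops(2) R_zero by (simp add: B_def \<phi>_def op_scale_simps)
    show "S + S' \<in> B" if SS: "S \<in> B" "S' \<in> B" for S S'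
    proof -
      have eq: "S + S' - op_scale (\<phi> (S + S')) (T 0) =
          (S - op_scale (\<phi> S) (T 0)) + (S' - op_scale (\<phi> S') (T 0))"
        by (simp add: \<phi>_def blinfun.add_left cinner_add_left op_scale_simps)
      have "S + S' - op_scale (\<phi> (S + S')) (T 0) \<in> R"
        unfolding eq using SS by (intro R_add) (auto simp: B_def)
      then show ?thesis using SS C_closed_ops by (simp add: B_def)
    qed
    show "op_scale c S \<in> B" if S: "S \<in> B" for c S
    proof -
      obtain r where "r \<in> R" "S = op_scale (\<phi> S) (T 0) + r" using BE[OF S] by blast
      then have "op_scale c S = op_scale (\<phi> (op_scale c S)) (T 0) + op_scale c r"
        by (metis (no_types, lifting) \<phi>_def cinner_cscale_left op_scale_apply op_scale_simps(1,3))
      then have "op_scale c S - op_scale (\<phi> (op_scale c S)) (T 0) = op_scale c r"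
        by (metis add_diff_cancel_left')
      then show ?thesis using S R_scale[OF \<open>r \<in> R\<close>] C_closed_ops by (simp add: B_def)
    qed
    show "S o\<^sub>L S' \<in> B" if SS: "S \<in> B" "S' \<in> B" for S S'
    proof -
      obtain r s where r: "r \<in> R" "S = op_scale (\<phi> S) (T 0) + r"
        and s: "s \<in> R" "S' = op_scale (\<phi> S') (T 0) + s" using BE SS by meson
      have C: "S \<in> C" "S' \<in> C" using SS by (auto simp: B_def)
      have "S o\<^sub>L S' = (op_scale (\<phi> S) (T 0) o\<^sub>L S') + (r o\<^sub>L S')"
        using r(2) compose_simps(1) by metis
      also have "op_scale (\<phi> S) (T 0) o\<^sub>L S' = op_scale (\<phi> S) (T 0 o\<^sub>L S')"
        by (simp add: compose_simps)
      also have "T 0 o\<^sub>L S' = (T 0 o\<^sub>L op_scale (\<phi> S') (T 0)) + (T 0 o\<^sub>L s)"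
        using s(2) compose_simps(2) by metis
      also have "T 0 o\<^sub>L op_scale (\<phi> S') (T 0) = 0"
        by (simp add: compose_simps T_bounded T_zero_square)
           (rule blinfun_eqI, simp)
      finally have "S o\<^sub>L S' = op_scale (\<phi> S) (T 0 o\<^sub>L s) + (r o\<^sub>L S')" by simp
      then have "S o\<^sub>L S' \<in> R"
        using R_add R_scale R_left[OF T_in_C s(1)] R_right[OF C(2) r(1)] by simp
      then show ?thesis
        using C C_closed_ops \<phi>_mult[OF C] by (simp add: B_def op_scale_simps)
    qed
  qed
  moreover have "closed B"
  proof -
    have "B = C \<inter> (\<lambda>a. a - op_scale (\<phi> a) (T 0)) -` R" by (auto simp: B_def)
    moreover have "continuous_on UNIV (\<lambda>a. a - op_scale (\<phi> a) (T 0))"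
      unfolding \<phi>_def
      by (intro continuous_intros bounded_linear.continuous_on[OF bounded_linear_op_scale_left])
    ultimately show ?thesis using closed_C closed_R by (simp add: closed_Int closed_vimage)
  qed
  moreover have "T n \<in> B" for n
  proof (cases "n = 0")
    case True
    have "\<phi> (T 0) = 1" by (simp add: \<phi>_def T_zero cinner_e)
    then show ?thesis using True R_zero T_in_C by (simp add: B_def op_scale_simps)
  next
    case False
    then have "\<phi> (T n) = 0" by (simp add: \<phi>_def T_pos)
    then show ?thesis using False T_R T_in_C by (simp add: B_def op_scale_simps)
  qed
  ultimately have "C \<subseteq> B" by (rule C_least)
  then obtain r where r: "r \<in> R" "u = op_scale (\<phi> u) (T 0) + r" using BE u(1) by blast
  have "T 0 o\<^sub>L op_scale (\<phi> u) (T 0) = 0"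
    by (simp add: compose_simps T_bounded T_zero_square) (rule blinfun_eqI, simp)
  then have "T 0 o\<^sub>L u = T 0 o\<^sub>L r" using r(2) compose_simps(2) by (metis add_0)
  moreover have "T 0 o\<^sub>L r \<in> J" using R_left[OF T_in_C r(1)] by (simp add: R_def)
  ultimately have "T 0 \<in> J" using u(2)[OF T_in_C[of 0]] J'(3) by (metis diff_add_cancel)
  then have "u \<in> J" using r J' by (metis (no_types, lifting) R_def mem_Collect_eq)
  then show False using u(3) by blast
qed

lemma jacobson_radical_C: "jacobson_radical (operator_algebra C) = C"
  using no_maximal_modular_left_ideal by (simp add: jacobson_radical_def)

section \<open>A non-quasi-regular element of the bidual\<close>

abbreviation A :: "('h \<Rightarrow>\<^sub>L 'h) normed_algebra" where
  "A \<equiv> operator_algebra C"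

sublocale A: complex_normed_algebra "operator_algebra C"
  by (rule complex_normed_algebra_operator_algebra[OF subalgebra_C])

sublocale bidual: complex_algebra "bidual (operator_algebra C)"
  by (rule A.complex_algebra_bidual)

definition coef :: "'h \<Rightarrow> 'h \<Rightarrow> ('h \<Rightarrow>\<^sub>L 'h) \<Rightarrow> complex" where
  "coef x y = (\<lambda>a\<in>C. cinner (blinfun_apply a x) y)"

lemma coef_bound: "a \<in> C \<Longrightarrow> cmod (coef x y a) \<le> (norm x * norm y) * norm a"
proof -
  assume a: "a \<in> C"
  have "cmod (cinner (blinfun_apply a x) y) \<le> norm (blinfun_apply a x) * norm y"
    by (rule Cauchy_Schwarz)
  also have "\<dots> \<le> norm a * norm x * norm y"
    by (intro mult_right_mono norm_blinfun) simp
  finally show ?thesis using a by (simp add: coef_def mult_ac)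
qed

lemma coef_in_dual: "coef x y \<in> carrier (dual A)"
  by (rule dualI[where K = "norm x * norm y"])
     (use C_closed_ops coef_bound in
      \<open>simp_all add: coef_def blinfun.add_left cinner_add_left cinner_cscale_left\<close>)

lemma nrm_coef: "nrm (dual A) (coef x y) \<le> norm x * norm y"
  using coef_bound by (intro A.dual_nrm_le) simp_all

text \<open>The summands map distinct members of an orthonormal set to multiples of distinct members of
  another one.\<close>

lemma norm_sum_T:
  assumes "\<And>n. cmod (c n) \<le> 1"
  shows "norm (\<Sum>n<N. op_scale (c n) (T (Suc n))) \<le> 1"
proof (rule norm_blinfun_bound)
  fix x
  have "blinfun_apply (\<Sum>n<N. op_scale (c n) (T (Suc n))) x =
      (\<Sum>n<N. (c n * cinner x (e (2 * Suc n))) *\<^sub>C e (2 * Suc n + 1))"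
    by (simp add: blinfun.sum_left T_apply cscale_cscale)
  then have "(norm (blinfun_apply (\<Sum>n<N. op_scale (c n) (T (Suc n))) x))\<^sup>2 =
      (\<Sum>n<N. (cmod (c n * cinner x (e (2 * Suc n))))\<^sup>2)"
    by (simp only:) (rule norm_orthonormal_sum; simp add: cinner_e)
  also have "\<dots> \<le> (\<Sum>n<N. (cmod (cinner x (e (2 * Suc n))))\<^sup>2)"
    using assms by (intro sum_mono power_mono) (auto simp: norm_mult intro: mult_left_le_one_le)
  also have "\<dots> \<le> (norm x)\<^sup>2"
    by (rule Bessel) (auto simp: cinner_e)
  finally show "norm (blinfun_apply (\<Sum>n<N. op_scale (c n) (T (Suc n))) x) \<le> 1 * norm x"
    by (simp add: power2_le_iff_abs_le)
qed simp

text \<open>Duality of the sequence spaces \<open>c\<^sub>0\<close> and \<open>\<ell>\<^sub>1\<close>: coefficients of modulus at most 1 turn all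
  the values of \<open>f\<close> into their moduli.\<close>

lemma sum_functional_T_le:
  assumes f: "f \<in> carrier (dual A)"
  shows "(\<Sum>n<N. cmod (f (T (Suc n)))) \<le> nrm (dual A) f"
proof -
  define c where "c n = cnj (sgn (f (T (Suc n))))" for n
  let ?S = "\<Sum>n<N. op_scale (c n) (T (Suc n))"
  have S: "?S \<in> C \<and> f ?S = (\<Sum>n<N. f (op_scale (c n) (T (Suc n))))"
    by (rule dual_operator_algebra_sum[OF subalgebra_C f]) (auto simp: C_closed_ops T_in_C)
  have "f (op_scale (c n) (T (Suc n))) = complex_of_real (cmod (f (T (Suc n))))" for n
  proof -
    have "f (op_scale (c n) (T (Suc n))) = c n * f (T (Suc n))"
      using dual_scale[OF f, of "T (Suc n)" "c n"] T_in_C by simp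
    also have "\<dots> = complex_of_real (cmod (f (T (Suc n))))"
      using complex_norm_square[of "f (T (Suc n))"]
      by (cases "f (T (Suc n)) = 0")
         (auto simp: c_def sgn_div_norm scaleR_conv_of_real field_simps power2_eq_square)
    finally show ?thesis .
  qed
  then have eq: "f ?S = complex_of_real (\<Sum>n<N. cmod (f (T (Suc n))))"
    using S by simp
  have "(\<Sum>n<N. cmod (f (T (Suc n)))) = cmod (f ?S)"
    unfolding eq norm_of_real by (simp add: sum_nonneg)
  also have "\<dots> \<le> nrm (dual A) f"
    using S by (intro A.dual_nrm_upper[OF f]) (auto intro!: norm_sum_T simp: c_def norm_sgn)
  finally show ?thesis .
qed

lemma summable_functional_T:
  assumes "f \<in> carrier (dual A)"
  shows "summable (\<lambda>n. cmod (f (T (Suc n))))"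
  by (rule summableI_nonneg_bounded[OF _ sum_functional_T_le[OF assms]]) simp

text \<open>The weak-* limit of \<open>T 1 + \<dots> + T N\<close>.\<close>

definition T_sum :: "(('h \<Rightarrow>\<^sub>L 'h) \<Rightarrow> complex) \<Rightarrow> complex" where
  "T_sum = (\<lambda>f\<in>carrier (dual A). \<Sum>n. f (T (Suc n)))"

lemma T_sum_in_bidual: "T_sum \<in> carrier (dual (dual A))"
proof (rule dualI[where K = 1])
  show "T_sum \<in> extensional (carrier (dual A))" by (simp add: T_sum_def)
  fix f assume f: "f \<in> carrier (dual A)"
  note sf = summable_norm_cancel[OF summable_functional_T[OF f]]
  show "T_sum (add (dual A) f g) = T_sum f + T_sum g" if g: "g \<in> carrier (dual A)" for g
    using f g suminf_add[OF sf summable_norm_cancel[OF summable_functional_T[OF g]]]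
    by (simp add: T_sum_def A.dual_closed dual_ops_apply T_in_C)
  show "T_sum (scale (dual A) c f) = c * T_sum f" for c
    using f suminf_mult[OF sf] by (simp add: T_sum_def A.dual_closed dual_ops_apply T_in_C)
  have "cmod (T_sum f) \<le> (\<Sum>n. cmod (f (T (Suc n))))"
    using f summable_norm[OF summable_functional_T[OF f]] by (simp add: T_sum_def)
  also have "\<dots> \<le> nrm (dual A) f"
    by (rule suminf_le_const[OF summable_functional_T[OF f] sum_functional_T_le[OF f]])
  finally show "cmod (T_sum f) \<le> 1 * nrm (dual A) f" by simp
qed

text \<open>Only the summand \<open>T k\<close> of the limit moves the basis vector of index \<open>2k\<close>.\<close>

lemma T_sum_coef:
  assumes "k \<ge> 1" "a \<in> C"
  shows "T_sum (A.translate (coef (e (2 * k)) y) a) = cinner (a (e (2 * k + 1))) y"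
proof -
  have "T_sum (A.translate (coef (e (2 * k)) y) a) =
      (\<Sum>n. A.translate (coef (e (2 * k)) y) a (T (Suc n)))"
    using assms by (simp add: T_sum_def A.translate_closed coef_in_dual)
  also have "\<dots> = (\<Sum>n. if n = k - 1 then cinner (a (e (2 * k + 1))) y else 0)"
    using assms by (intro suminf_cong) (auto simp: A.translate_def coef_def T_in_C C_closed_ops T_pos)
  also have "\<dots> = cinner (a (e (2 * k + 1))) y"
    using sums_unique[OF sums_single[of "k - 1" "\<lambda>_. cinner (a (e (2 * k + 1))) y"]] by simp
  finally show ?thesis .
qed

definition W :: "(('h \<Rightarrow>\<^sub>L 'h) \<Rightarrow> complex) \<Rightarrow> complex" where
  "W = arens_product A T_sum (canonical A (T 0))"

lemma bidual_action_canonical_coef: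
  assumes "b \<in> C"
  shows "A.bidual_action (canonical A b) (coef x y) = coef (blinfun_apply b x) y"
proof (rule dual_eqI[where M = A])
  show "A.bidual_action (canonical A b) (coef x y) \<in> carrier (dual A)"
    using assms by (simp add: A.bidual_action_closed A.canonical_closed coef_in_dual)
  fix a assume "a \<in> carrier A"
  then show "A.bidual_action (canonical A b) (coef x y) a = coef (blinfun_apply b x) y a"
    using assms
    by (simp add: A.bidual_action_def A.canonical_apply A.translate_closed coef_in_dual)
       (simp add: A.translate_def coef_def C_closed_ops)
qed (rule coef_in_dual)

text \<open>First \<open>T 0\<close> moves the index \<open>2i + 1\<close> to \<open>2i + 2\<close>, then the limit moves it to \<open>2i + 3\<close>.\<close>

lemma bidual_action_W_coef:
  "A.bidual_action W (coef (e (2 * i + 1)) y) = coef (e (2 * i + 3)) y"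
proof -
  have "A.bidual_action W (coef (e (2 * i + 1)) y) = A.bidual_action T_sum (coef (e (2 * i + 2)) y)"
    unfolding W_def
    by (simp add: A.bidual_action_ops coef_in_dual T_sum_in_bidual A.canonical_closed T_in_C
        bidual_action_canonical_coef T_zero)
  also have "\<dots> = coef (e (2 * i + 3)) y"
  proof (rule dual_eqI[where M = A])
    fix a assume "a \<in> carrier A"
    then show "A.bidual_action T_sum (coef (e (2 * i + 2)) y) a = coef (e (2 * i + 3)) y a"
      using T_sum_coef[of "Suc i" a y] by (simp add: A.bidual_action_def coef_def numeral_3_eq_3)
  qed (auto intro: A.bidual_action_closed coef_in_dual T_sum_in_bidual)
  finally show ?thesis .
qed

lemma W_coef: "W (coef (e (2 * i + 1)) y) = cinner (e (2 * i + 3)) y"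
proof -
  have "W (coef (e (2 * i + 1)) y) = T_sum (coef (e (2 * i + 2)) y)"
    unfolding W_def
    by (simp add: A.arens_product_apply coef_in_dual bidual_action_canonical_coef T_in_C T_zero)
  also have "\<dots> = (\<Sum>n. if n = i then cinner (e (2 * i + 3)) y else 0)"
    unfolding T_sum_def using coef_in_dual
    by (auto intro!: suminf_cong simp: coef_def T_in_C T_pos numeral_3_eq_3)
  also have "\<dots> = cinner (e (2 * i + 3)) y"
    using sums_unique[OF sums_single[of i "\<lambda>_. cinner (e (2 * i + 3)) y"]] by simp
  finally show ?thesis .
qed

text \<open>If \<open>b - bW = W\<close>, then at the coefficient functional of \<open>x = e\<^sub>2\<^sub>i\<^sub>+\<^sub>1\<close> and any \<open>y\<close>
  the left-hand side is a difference of values of \<open>b\<close> at consecutive odd indices. For \<open>y\<close> the sum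
  of \<open>m\<close> odd basis vectors, each of the first \<open>m\<close> differences equals 1, whereas the values of
  \<open>b\<close> are bounded by a multiple of \<open>\<parallel>y\<parallel> = \<surd>m\<close>.\<close>

lemma W_not_quasi_regular:
  assumes b: "b \<in> carrier (dual (dual A))"
  shows "bidual.sub_mult W b \<noteq> W"
proof
  assume eq: "bidual.sub_mult W b = W"
  have step: "b (coef (e (2 * i + 1)) y) - b (coef (e (2 * Suc i + 1)) y) = cinner (e (2 * i + 3)) y" for i y
  proof -
    have "W (coef (e (2 * i + 1)) y) = bidual.sub_mult W b (coef (e (2 * i + 1)) y)"
      by (simp only: eq)
    also have "\<dots> = b (coef (e (2 * i + 1)) y) - b (coef (e (2 * i + 3)) y)"
      by (simp add: bidual.sub_mult_def A.bidual_simps dual_ops_apply coef_in_dual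
          A.arens_product_apply bidual_action_W_coef[simplified])
    finally show ?thesis using W_coef[of i y] by (simp add: numeral_3_eq_3)
  qed
  obtain K where K: "K \<ge> 0" "\<And>f. f \<in> carrier (dual A) \<Longrightarrow> cmod (b f) \<le> K * nrm (dual A) f"
    using A.bidual_bound[OF b] by blast
  \<comment> \<open>For this \<open>m\<close> the inequality \<open>m \<le> 2 K \<surd>m\<close> at the end is false.\<close>
  obtain m :: nat where m: "real m > (2 * K)\<^sup>2" using reals_Archimedean2 by blast
  define y where "y = (\<Sum>i<m. 1 *\<^sub>C e (2 * i + 3))"
  have "(norm y)\<^sup>2 = (\<Sum>i<m. (cmod 1)\<^sup>2)"
    unfolding y_def by (rule norm_orthonormal_sum) (auto simp: cinner_e)
  then have ny: "norm y = sqrt (real m)"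
    by (metis (no_types) card_lessThan norm_ge_zero norm_one one_power2 real_sqrt_unique sum_constant mult_1_right)
  have "cinner (e (2 * i + 3)) y = 1" if "i < m" for i
    unfolding y_def using that by (simp add: cinner_sum_right cscale_one cinner_e)
  then have "(\<Sum>i<m. b (coef (e (2 * i + 1)) y) - b (coef (e (2 * Suc i + 1)) y)) = of_nat m"
    by (simp only: step) simp
  then have tel: "b (coef (e 1) y) - b (coef (e (2 * m + 1)) y) = of_nat m"
    using sum_lessThan_telescope'[of "\<lambda>i. b (coef (e (2 * i + 1)) y)" m] by simp
  have bound: "cmod (b (coef (e i) y)) \<le> K * sqrt (real m)" if "i \<ge> 1" for i
  proof -
    have "(norm (e i))\<^sup>2 = 1"
      using cinner_self[of "e i"] cinner_e[of i i] that by (metis of_real_eq_1_iff)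
    then have "norm (e i) = 1" by (simp add: power2_eq_1_iff) (smt (verit) norm_ge_zero)
    then have "nrm (dual A) (coef (e i) y) \<le> sqrt (real m)"
      using nrm_coef[of "e i" y] ny by simp
    then have "K * nrm (dual A) (coef (e i) y) \<le> K * sqrt (real m)"
      using K(1) by (rule mult_left_mono)
    then show ?thesis using K(2)[OF coef_in_dual] order_trans by blast
  qed
  have "real m = cmod (b (coef (e 1) y) - b (coef (e (2 * m + 1)) y))"
    unfolding tel by simp
  also have "\<dots> \<le> 2 * K * sqrt (real m)"
    using norm_triangle_ineq4[of "b (coef (e 1) y)" "b (coef (e (2 * m + 1)) y)"]
      bound[of 1] bound[of "2 * m + 1"] by simp
  finally have le: "sqrt (real m) * sqrt (real m) \<le> 2 * K * sqrt (real m)" by simp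
  have "sqrt (real m) > 2 * K"
    using m K(1) by (intro real_less_rsqrt)
  moreover from this have "sqrt (real m) > 0" using K(1) by linarith
  ultimately have "2 * K * sqrt (real m) < sqrt (real m) * sqrt (real m)"
    by (intro mult_strict_right_mono)
  with le show False by linarith
qed

text \<open>Otherwise the multiple \<open>W\<close> of this element would have a left quasi-inverse.\<close>

lemma T_zero_not_in_radical_bidual: "canonical A (T 0) \<notin> jacobson_radical (bidual A)"
proof
  assume "canonical A (T 0) \<in> jacobson_radical (bidual A)"
  moreover have "T_sum \<in> carrier (bidual A)"
    by (simp add: A.bidual_simps T_sum_in_bidual)
  ultimately show False
    using bidual.jacobson_radical_left_quasi_regular[of "canonical A (T 0)" T_sum]
      W_not_quasi_regular by (auto simp: A.bidual_simps W_def)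
qed

end

theorem theorem1p2:
  fixes e :: "nat \<Rightarrow> 'h::chilbert_space"
    and T :: "nat \<Rightarrow> 'h \<Rightarrow>\<^sub>L 'h"
    and A :: "('h \<Rightarrow>\<^sub>L 'h) normed_algebra"
  assumes basis: "orthonormal_basis e {1..}"
    and T_bounded: "\<And>n. T n \<in> bounded_ops"
    and T_zero: "\<And>i. i \<ge> 1 \<Longrightarrow> T 0 (e i) = (if odd i then e (i + 1) else 0)"
    and T_pos: "\<And>n i. n \<ge> 1 \<Longrightarrow> i \<ge> 1 \<Longrightarrow>
                  T n (e i) = (if i = 2 * n then e (2 * n + 1) else 0)"
    and A_def: "A = operator_algebra (closed_subalgebra_generated (range T))"
  shows "canonical A (T 0) \<notin> jacobson_radical (bidual A) \<and>
         canonical A ` carrier A \<inter> jacobson_radical (bidual A) \<subset> canonical A ` carrier A \<and>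
         carrier A = jacobson_radical A"
proof -
  interpret ladder e T
    by unfold_locales (use basis T_bounded T_zero T_pos in auto)
  have A: "A = operator_algebra C" by (simp add: A_def C_def)
  have "canonical A (T 0) \<notin> jacobson_radical (bidual A)"
    unfolding A by (rule T_zero_not_in_radical_bidual)
  moreover have "canonical A (T 0) \<in> canonical A ` carrier A"
    unfolding A using T_in_C by simp
  moreover have "carrier A = jacobson_radical A"
    unfolding A by (simp add: jacobson_radical_C)
  ultimately show ?thesis by blast
qed

end
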